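(* Let $D\subset\overline{\mathbb{C}}$ be a domain possessing a Green function $g(z,\zeta)$, let $K\subset D\setminus\{\infty\}$ be compact, let $f:K\to\mathbb{R}\cup\{+\infty\}$ be lower semicontinuous with $\mathrm{cap}(\{z\in K: f(z)<+\infty\})>0$, and let $\lambda$ be a probability measure on $K$ with $\iint g(z,\zeta)\,d\lambda(z)\,d\lambda(\zeta)<\infty$. Let $\mu_{\lambda,R}^*$ be the unique measure satisfying $0\le\mu_{\lambda,R}^*\le R\lambda$ and $J_f(\mu_{\lambda,R}^* )=v_{f,\lambda}(R):=\inf\{J_f(\mu):0\le\mu\le R\lambda\}$. If $(R_N)_N$ is a convergent sequence of positive numbers with limit $R$, then $\mu_{\lambda,R_N}^*$ converges in the weak-star topology to $\mu_{\lambda,R}^*$ and $v_{f,\lambda}(R)=\lim_{N\to\infty}v_{f,\lambda}(R_N)$.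
   Context: $g(z,\zeta)$ is the Green function of $D$ with logarithmic pole ($g(z,z)=+\infty$); $\mathrm{cap}$ is logarithmic capacity. $J_f(\mu)=\iint g(z,\zeta)\,d\mu(z)\,d\mu(\zeta)+2\int f\,d\mu$ for finite positive Borel measures $\mu$ on $K$. $\sigma\le\tau$ means that $\tau-\sigma$ is a positive measure. Existence and uniqueness of the minimizer $\mu_{\lambda,R}^*$ is known. *)

theory Defs
  imports "HOL-Probability.Probability_Measure"
begin

section \<open>The Riemann sphere and harmonic functions on it\<close>

text \<open>The extended plane is the one-point compactification of the plane; the point at infinity is
  \<^term>\<open>None\<close>, and a finite point \<open>z\<close> is \<open>Some z\<close>.\<close>

type_synonym sphere = "complex option"

abbreviation sphere_topology :: "sphere topology" where
  "sphere_topology \<equiv> Alexandroff_compactification euclidean"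

definition sphere_domain :: "sphere set \<Rightarrow> bool" where
  "sphere_domain D \<longleftrightarrow> D \<noteq> {} \<and> openin sphere_topology D \<and> connectedin sphere_topology D"

text \<open>The inverse of the chart \<open>z \<mapsto> 1/z\<close> at infinity.\<close>

definition chart_infinity :: "complex \<Rightarrow> sphere" where
  "chart_infinity z = (if z = 0 then None else Some (inverse z))"

text \<open>Twice continuously differentiable solutions of the Laplace equation: \<open>ux\<close>, \<open>uy\<close> are the first
  and \<open>uxx\<close>, \<open>uxy\<close>, \<open>uyx\<close>, \<open>uyy\<close> the second partial derivatives.\<close>

definition harmonic_on :: "complex set \<Rightarrow> (complex \<Rightarrow> real) \<Rightarrow> bool" where
  "harmonic_on S u \<longleftrightarrow> open S \<and>
     (\<exists>ux uy uxx uxy uyx uyy.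
        (\<forall>z\<in>S. (u has_derivative (\<lambda>h. ux z * Re h + uy z * Im h)) (at z) \<and>
               (ux has_derivative (\<lambda>h. uxx z * Re h + uxy z * Im h)) (at z) \<and>
               (uy has_derivative (\<lambda>h. uyx z * Re h + uyy z * Im h)) (at z)) \<and>
        continuous_on S uxx \<and> continuous_on S uxy \<and> continuous_on S uyx \<and> continuous_on S uyy \<and>
        (\<forall>z\<in>S. uxx z + uyy z = (0::real)))"

definition sphere_harmonic_on :: "sphere set \<Rightarrow> (sphere \<Rightarrow> real) \<Rightarrow> bool" where
  "sphere_harmonic_on W u \<longleftrightarrow> openin sphere_topology W \<and>
     harmonic_on {z. Some z \<in> W} (\<lambda>z. u (Some z)) \<and>
     (None \<in> W \<longrightarrow> (\<exists>e>0. harmonic_on (ball 0 e) (\<lambda>z. u (chart_infinity z))))"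

section \<open>Green functions\<close>

text \<open>\<open>u\<close> minus \<open>-log |z - a|\<close> (for \<open>a = \<infinity>\<close>: minus \<open>log |z|\<close>) extends harmonically across \<open>a\<close>.\<close>

definition log_pole_at :: "sphere \<Rightarrow> (sphere \<Rightarrow> real) \<Rightarrow> bool" where
  "log_pole_at a u \<longleftrightarrow>
     (case a of
        Some w \<Rightarrow> \<exists>e>0. \<exists>h. harmonic_on (ball w e) h \<and>
                   (\<forall>z\<in>ball w e - {w}. u (Some z) = h z - ln (cmod (z - w)))
      | None \<Rightarrow> \<exists>e>0. \<exists>h. harmonic_on (ball 0 e) h \<and>
                   (\<forall>z\<in>ball 0 e - {0}. u (Some (inverse z)) = h z + ln (cmod (inverse z))))"

definition positive_harmonic_with_pole :: "sphere set \<Rightarrow> sphere \<Rightarrow> (sphere \<Rightarrow> ereal) \<Rightarrow> bool" where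
  "positive_harmonic_with_pole D a u \<longleftrightarrow>
     u a = \<infinity> \<and> (\<forall>z\<in>D - {a}. 0 \<le> u z \<and> u z < \<infinity>) \<and>
     sphere_harmonic_on (D - {a}) (\<lambda>z. real_of_ereal (u z)) \<and>
     log_pole_at a (\<lambda>z. real_of_ereal (u z))"

text \<open>The Green function with pole at \<open>a\<close> is the smallest positive harmonic function on
  \<open>D - {a}\<close> with a logarithmic pole at \<open>a\<close>.  This makes sense on every domain, without
  regularity of the boundary; a domain possesses a Green function iff such a \<open>g\<close> exists, and then
  \<open>g\<close> is unique on \<open>D \<times> D\<close>.  The second argument is the pole.\<close>

definition green_function :: "sphere set \<Rightarrow> (sphere \<Rightarrow> sphere \<Rightarrow> ereal) \<Rightarrow> bool" where
  "green_function D g \<longleftrightarrow>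
     (\<forall>a\<in>D. positive_harmonic_with_pole D a (\<lambda>z. g z a) \<and>
        (\<forall>u. positive_harmonic_with_pole D a u \<longrightarrow> (\<forall>z\<in>D. g z a \<le> u z)))"

section \<open>Measures, energies, capacity\<close>

definition borel_measure_on :: "complex set \<Rightarrow> complex measure \<Rightarrow> bool" where
  "borel_measure_on K \<mu> \<longleftrightarrow> sets \<mu> = sets (restrict_space borel K) \<and> finite_measure \<mu>"

text \<open>Integral of an extended real function as the integral of the positive part minus that of the
  negative part.  It is only used below for functions bounded from below and finite measures, so
  that the second term is finite.\<close>

definition ereal_integral :: "'a measure \<Rightarrow> ('a \<Rightarrow> ereal) \<Rightarrow> ereal" where
  "ereal_integral M f =
     enn2ereal (\<integral>\<^sup>+ x. e2ennreal (f x) \<partial>M) - enn2ereal (\<integral>\<^sup>+ x. e2ennreal (- f x) \<partial>M)"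

definition energy :: "(complex \<Rightarrow> complex \<Rightarrow> ereal) \<Rightarrow> complex measure \<Rightarrow> ereal" where
  "energy k \<mu> = ereal_integral \<mu> (\<lambda>\<zeta>. ereal_integral \<mu> (\<lambda>z. k z \<zeta>))"

definition log_kernel :: "complex \<Rightarrow> complex \<Rightarrow> ereal" where
  "log_kernel z \<zeta> = (if z = \<zeta> then \<infinity> else ereal (- ln (cmod (z - \<zeta>))))"

text \<open>Logarithmic capacity: the supremum of \<open>exp (- I(\<mu>))\<close> over all Borel probability measures
  \<open>\<mu>\<close> with compact support in \<open>E\<close>, where \<open>I(\<mu>) > -\<infinity>\<close> is the logarithmic energy.\<close>

definition log_capacity :: "complex set \<Rightarrow> ennreal" where
  "log_capacity E =
     (SUP \<mu> \<in> {\<mu>. prob_space \<mu> \<and> (\<exists>C. compact C \<and> C \<subseteq> E \<and> borel_measure_on C \<mu>)}.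
        if energy log_kernel \<mu> = \<infinity> then 0
        else ennreal (exp (- real_of_ereal (energy log_kernel \<mu>))))"

definition lsc_on :: "complex set \<Rightarrow> (complex \<Rightarrow> ereal) \<Rightarrow> bool" where
  "lsc_on K f \<longleftrightarrow> (\<forall>c. openin (top_of_set K) {z \<in> K. c < f z})"

text \<open>Weak-star convergence in the dual of the continuous functions on \<open>K\<close>.\<close>

definition weak_star_converges ::
  "complex set \<Rightarrow> (nat \<Rightarrow> complex measure) \<Rightarrow> complex measure \<Rightarrow> bool" where
  "weak_star_converges K \<mu>s \<mu> \<longleftrightarrow>
     (\<forall>\<phi> :: complex \<Rightarrow> real. continuous_on K \<phi> \<longrightarrow>
        (\<lambda>N. integral\<^sup>L (\<mu>s N) \<phi>) \<longlonglongrightarrow> integral\<^sup>L \<mu> \<phi>)"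

section \<open>The constrained weighted energy problem\<close>

definition weighted_energy ::
  "(sphere \<Rightarrow> sphere \<Rightarrow> ereal) \<Rightarrow> (complex \<Rightarrow> ereal) \<Rightarrow> complex measure \<Rightarrow> ereal" where
  "weighted_energy g f \<mu> =
     energy (\<lambda>z \<zeta>. g (Some z) (Some \<zeta>)) \<mu> + 2 * ereal_integral \<mu> f"

text \<open>Both sides of the order live on the same sigma-algebra, so it is the setwise order: it says
  that \<open>R lam - \<mu>\<close> is a positive measure.\<close>

definition constrained_measures ::
  "complex set \<Rightarrow> complex measure \<Rightarrow> real \<Rightarrow> complex measure set" where
  "constrained_measures K lam R = {\<mu>. borel_measure_on K \<mu> \<and> \<mu> \<le> scale_measure (ennreal R) lam}"

definition min_energy ::
  "(sphere \<Rightarrow> sphere \<Rightarrow> ereal) \<Rightarrow> (complex \<Rightarrow> ereal) \<Rightarrow> complex set \<Rightarrow> complex measure \<Rightarrow> real \<Rightarrow> ereal"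
  where
  "min_energy g f K lam R = (INF \<mu> \<in> constrained_measures K lam R. weighted_energy g f \<mu>)"

definition constrained_minimizer ::
  "(sphere \<Rightarrow> sphere \<Rightarrow> ereal) \<Rightarrow> (complex \<Rightarrow> ereal) \<Rightarrow> complex set \<Rightarrow> complex measure \<Rightarrow> real \<Rightarrow>
     complex measure \<Rightarrow> bool" where
  "constrained_minimizer g f K lam R \<mu> \<longleftrightarrow>
     \<mu> \<in> constrained_measures K lam R \<and> weighted_energy g f \<mu> = min_energy g f K lam R"

definition unique_constrained_minimizer ::
  "(sphere \<Rightarrow> sphere \<Rightarrow> ereal) \<Rightarrow> (complex \<Rightarrow> ereal) \<Rightarrow> complex set \<Rightarrow> complex measure \<Rightarrow> real \<Rightarrow>
     complex measure \<Rightarrow> bool" where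
  "unique_constrained_minimizer g f K lam R \<mu> \<longleftrightarrow>
     constrained_minimizer g f K lam R \<mu> \<and>
     (\<forall>\<nu>. constrained_minimizer g f K lam R \<nu> \<longrightarrow> \<nu> = \<mu>)"

end

theory Submission
  imports Defs "HOL-Library.Diagonal_Subsequence"
begin

text \<open>All measures involved are dominated by a fixed multiple of \<open>\<lambda>\<close>, so every sequence of minimizers
  has a subsequence converging on all Borel sets to some \<open>P \<le> R \<lambda>\<close>; this mode of convergence passes
  to products, and \<open>J\<close> is lower semicontinuous along it for any measurable nonnegative kernel.
  Hence \<open>J(P)\<close> is at most the lower limit of \<open>v(R\<^sub>N)\<close>.  Conversely \<open>v(R\<^sub>N)\<close> is at most the energy of
  the rescaled minimizer \<open>min(1, R\<^sub>N / R) \<mu>\<^sup>*\<close>, which tends to \<open>v(R)\<close>.  So \<open>P\<close> is a minimizer for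
  \<open>R\<close>, and uniqueness identifies it with \<open>\<mu>\<^sup>*\<close>.  A constant \<open>c\<close> with \<open>f \<ge> - c\<close> is added to \<open>f\<close>, so that
  only integrals of nonnegative functions occur; the correction \<open>2 c \<mu>(K)\<close> is continuous.

  Measurability of the Green function on \<open>K \<times> K\<close> needs neither its symmetry nor Harnack's inequality:
  by minimality, \<open>g(\<sqdot>, a')\<close> is dominated by \<open>g(\<sqdot>, a) + log |(z - a) / (z - a')| + \<epsilon>\<close> with
  \<open>\<epsilon> = O(|a - a'|)\<close>, hence \<open>g\<close> is jointly upper semicontinuous.\<close>

subsection \<open>Setwise convergence of dominated measures\<close>

lemma finite_measure_mono_measure:
  assumes "finite_measure M" "sets N = sets M" "N \<le> M"
  shows "finite_measure N"
proof
  have "emeasure N (space N) \<le> emeasure M (space M)"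
    using assms le_measure[of N M] sets_eq_imp_space_eq[of N M] by auto
  then show "emeasure N (space N) \<noteq> \<infinity>"
    using finite_measure.emeasure_finite[OF assms(1), of "space M"] by (auto simp: top_unique)
qed

text \<open>Tannery's theorem with the majorant \<open>measure M (A k)\<close>, summable because
  \<open>M\<close> is finite. The common bound \<open>M\<close> keeps mass from escaping along the
  union, so countable additivity survives the limit.\<close>

lemma tendsto_setwise_UNION:
  fixes M :: "'a measure" and N :: "nat \<Rightarrow> 'a measure"
  assumes M: "finite_measure M"
    and sets: "\<And>n. sets (N n) = sets M" and le: "\<And>n. N n \<le> M"
    and A: "range A \<subseteq> sets M" "disjoint_family A"
    and lim: "\<And>k. (\<lambda>n. measure (N n) (A k)) \<longlonglongrightarrow> l k"
  shows "summable (\<lambda>k. \<bar>l k\<bar>)" and "(\<lambda>n. measure (N n) (\<Union>k. A k)) \<longlonglongrightarrow> (\<Sum>k. l k)"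
proof -
  interpret M: finite_measure M by fact
  have N: "finite_measure (N n)" for n
    by (rule finite_measure_mono_measure[OF M sets le])
  have bound: "norm (measure (N n) (A k)) \<le> measure M (A k)" for n k
  proof -
    have "emeasure (N n) (A k) \<le> emeasure M (A k)"
      using le_measure[OF sets] le A by (metis range_subsetD sets)
    then show ?thesis
      using N by (simp add: finite_measure.emeasure_eq_measure M.emeasure_eq_measure)
  qed
  have *: "measure (N n) (\<Union>k. A k) = (\<Sum>k. measure (N n) (A k))" for n
    using finite_measure.finite_measure_UNION[OF N[of n], of A] A by (simp add: sets sums_iff)
  have sm: "summable (\<lambda>k. measure M (A k))"
    using M.finite_measure_UNION[OF A] by (simp add: sums_iff)
  have "eventually (\<lambda>n. summable (\<lambda>k. norm (measure (N n) (A k)))) sequentially \<and>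
      summable (\<lambda>k. norm (l k)) \<and>
      ((\<lambda>n. suminf (\<lambda>k. measure (N n) (A k))) \<longlongrightarrow> suminf l) sequentially"
    by (rule tannerys_theorem[OF lim _ sm]) (auto simp: bound[simplified] intro!: always_eventually)
  then show "summable (\<lambda>k. \<bar>l k\<bar>)" "(\<lambda>n. measure (N n) (\<Union>k. A k)) \<longlonglongrightarrow> (\<Sum>k. l k)"
    by (auto simp: *)
qed

text \<open>Dynkin argument: the sets on which the measures converge are closed under complements,
  as \<open>space M\<close> lies in \<open>G\<close>, and under disjoint unions by the previous
  lemma. Hence they exhaust the sigma-algebra generated by the intersection-stable \<open>G\<close>.
  The same lemma makes the limit countably additive.\<close>

lemma setwise_limit_exists:
  fixes M :: "'a measure" and N :: "nat \<Rightarrow> 'a measure"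
  assumes M: "finite_measure M"
    and sets: "\<And>n. sets (N n) = sets M" and le: "\<And>n. N n \<le> M"
    and G: "Int_stable G" "G \<subseteq> Pow (space M)" "sets M = sigma_sets (space M) G" "space M \<in> G"
    and conv: "\<And>A. A \<in> G \<Longrightarrow> convergent (\<lambda>n. measure (N n) A)"
  obtains P where "sets P = sets M" "P \<le> M"
    "\<And>A. A \<in> sets M \<Longrightarrow> (\<lambda>n. emeasure (N n) A) \<longlonglongrightarrow> emeasure P A"
proof -
  interpret M: finite_measure M by fact
  have N: "finite_measure (N n)" for n
    by (rule finite_measure_mono_measure[OF M sets le])
  have sp: "space (N n) = space M" for n
    using sets by (rule sets_eq_imp_space_eq)
  have conv': "convergent (\<lambda>n. measure (N n) A)" if "A \<in> sigma_sets (space M) G" for A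
    using G(1,2) that
  proof (induction rule: sigma_sets_induct_disjoint)
    case (compl A)
    have "measure (N n) (space M - A) = measure (N n) (space M) - measure (N n) A" for n
      using finite_measure.finite_measure_compl[OF N[of n], of A] compl(1) G(3) by (simp add: sets sp)
    then show ?case
      using convergent_diff[OF conv[OF G(4)] compl(2)] by simp
  next
    case (union A)
    then have "\<And>k. (\<lambda>n. measure (N n) (A k)) \<longlonglongrightarrow> lim (\<lambda>n. measure (N n) (A k))"
      by (simp add: convergent_LIMSEQ_iff)
    from tendsto_setwise_UNION(2)[OF M sets le _ union(1) this] show ?case
      using union(2) G(3) by (auto intro: convergentI)
  qed (auto simp: conv convergent_const)
  define p where "p A = lim (\<lambda>n. measure (N n) A)" for A
  have p: "(\<lambda>n. measure (N n) A) \<longlonglongrightarrow> p A" if "A \<in> sets M" for A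
    using conv' that G(3) by (simp add: p_def convergent_LIMSEQ_iff)
  have p0: "0 \<le> p A" if "A \<in> sets M" for A
    using p[OF that] by (rule LIMSEQ_le_const) simp
  define P where "P = measure_of (space M) (sets M) (\<lambda>A. ennreal (p A))"
  have setsP: "sets P = sets M"
    by (simp add: P_def)
  have emP: "emeasure P A = ennreal (p A)" if "A \<in> sets M" for A
    unfolding P_def
  proof (rule emeasure_measure_of_sigma)
    show "positive (sets M) (\<lambda>A. ennreal (p A))"
      by (simp add: positive_def p_def)
    show "countably_additive (sets M) (\<lambda>A. ennreal (p A))"
    proof (rule countably_additiveI)
      fix A :: "nat \<Rightarrow> 'a set"
      assume A: "range A \<subseteq> sets M" "disjoint_family A" "(\<Union>i. A i) \<in> sets M"
      have l: "(\<lambda>n. measure (N n) (A k)) \<longlonglongrightarrow> p (A k)" for k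
        using A by (intro p) auto
      have "p (\<Union>i. A i) = (\<Sum>k. p (A k))"
        using p[OF A(3)] tendsto_setwise_UNION(2)[OF M sets le A(1,2) l] by (rule LIMSEQ_unique)
      moreover have "summable (\<lambda>k. p (A k))"
        using tendsto_setwise_UNION(1)[OF M sets le A(1,2) l] by (rule summable_rabs_cancel)
      ultimately show "(\<Sum>i. ennreal (p (A i))) = ennreal (p (\<Union>i. A i))"
        using p0 A by (subst suminf_ennreal2) auto
    qed
  qed (use that in \<open>auto intro: sets.sigma_algebra_axioms\<close>)
  have lim: "(\<lambda>n. emeasure (N n) A) \<longlonglongrightarrow> emeasure P A" if "A \<in> sets M" for A
    using p[OF that] N that by (simp add: emP finite_measure.emeasure_eq_measure)
  have "emeasure P A \<le> emeasure M A" if "A \<in> sets M" for A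
    using lim[OF that]
  proof (rule LIMSEQ_le_const2)
    show "\<exists>N'. \<forall>n\<ge>N'. emeasure (N n) A \<le> emeasure M A"
      using le le_measure[OF sets] that sets by blast
  qed
  then have "P \<le> M"
    by (simp add: le_measure setsP)
  with setsP lim show thesis
    by (intro that)
qed

text \<open>For each generator \<open>A k\<close> the values lie in the compact interval from 0 to
  \<open>measure M (A k)\<close>, so a diagonal subsequence converges on the whole countable
  generator; \<open>setwise_limit_exists\<close> extends this to all measurable sets.\<close>

lemma setwise_compact:
  fixes M :: "'a measure" and N :: "nat \<Rightarrow> 'a measure"
  assumes M: "finite_measure M"
    and sets: "\<And>n. sets (N n) = sets M" and le: "\<And>n. N n \<le> M"
    and G: "Int_stable G" "G \<subseteq> Pow (space M)" "sets M = sigma_sets (space M) G" "space M \<in> G"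
    and cG: "countable G"
  obtains r P where "strict_mono (r :: nat \<Rightarrow> nat)" "sets P = sets M" "P \<le> M"
    "\<And>A. A \<in> sets M \<Longrightarrow> (\<lambda>n. emeasure (N (r n)) A) \<longlonglongrightarrow> emeasure P A"
proof -
  interpret M: finite_measure M by fact
  have N: "finite_measure (N n)" for n
    by (rule finite_measure_mono_measure[OF M sets le])
  define A where "A = from_nat_into G"
  have A: "range A = G"
    using G(4) cG by (auto simp: A_def intro!: range_from_nat_into)
  interpret subseqs "\<lambda>k s. convergent (\<lambda>n. measure (N (s n)) (A k))"
  proof
    fix k and s :: "nat \<Rightarrow> nat"
    have "A k \<in> sets M"
      using A G(3) by auto
    then have "emeasure (N n) (A k) \<le> emeasure M (A k)" for n
      using le le_measure[OF sets] sets by blast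
    then have "measure (N n) (A k) \<in> {0..measure M (A k)}" for n
      using N by (simp add: finite_measure.emeasure_eq_measure M.emeasure_eq_measure)
    then obtain l r where "strict_mono r" "((\<lambda>n. measure (N (s n)) (A k)) \<circ> r) \<longlonglongrightarrow> l"
      using seq_compactE[OF compact_imp_seq_compact[OF compact_Icc],
          of "\<lambda>n. measure (N (s n)) (A k)"] by metis
    then show "\<exists>r. strict_mono r \<and> convergent (\<lambda>n. measure (N ((s \<circ> r) n)) (A k))"
      by (auto simp: comp_def convergent_def)
  qed
  have conv: "convergent (\<lambda>n. measure (N (diagseq n)) B)" if "B \<in> G" for B
  proof -
    obtain k where k: "B = A k"
      using A \<open>B \<in> G\<close> by blast
    \<comment> \<open>Only from index \<open>Suc k\<close> on is the diagonal sequence known to be a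
      subsequence of the one chosen for \<open>A k\<close>; the dropped initial segment does not
      affect convergence.\<close>
    have "convergent (\<lambda>n. measure (N ((diagseq \<circ> ((+) (Suc k))) n)) (A k))"
    proof (rule diagseq_holds)
      fix r s n
      assume "strict_mono (r :: nat \<Rightarrow> nat)" "convergent (\<lambda>i. measure (N (s i)) (A n))"
      then show "convergent (\<lambda>i. measure (N ((s \<circ> r) i)) (A n))"
        using convergent_subseq_convergent[of "\<lambda>i. measure (N (s i)) (A n)" r] by (simp add: comp_def)
    qed
    then show ?thesis
      using convergent_ignore_initial_segment[of "\<lambda>n. measure (N (diagseq n)) (A k)" "Suc k"]
      by (simp add: k comp_def add.commute)
  qed
  obtain P where "sets P = sets M" "P \<le> M"
    "\<And>B. B \<in> sets M \<Longrightarrow> (\<lambda>n. emeasure (N (diagseq n)) B) \<longlonglongrightarrow> emeasure P B"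
    using setwise_limit_exists[of M "\<lambda>n. N (diagseq n)", OF M sets le G conv] by blast
  then show thesis
    using that subseq_diagseq by blast
qed

section \<open>Lower semicontinuity of integrals, and products of measures\<close>

text \<open>Fatou's lemma with varying measures. Integrals of simple functions are finite
  combinations of measures of sets and therefore converge; a supremum of such integrals is lower
  semicontinuous.\<close>

lemma nn_integral_liminf_setwise:
  fixes N :: "nat \<Rightarrow> 'a measure" and u :: "'a \<Rightarrow> ennreal"
  assumes u: "u \<in> borel_measurable P"
    and sets: "\<And>n. sets (N n) = sets P"
    and lim: "\<And>A. A \<in> sets P \<Longrightarrow> (\<lambda>n. emeasure (N n) A) \<longlonglongrightarrow> emeasure P A"
  shows "(\<integral>\<^sup>+x. u x \<partial>P) \<le> liminf (\<lambda>n. \<integral>\<^sup>+x. u x \<partial>N n)"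
proof -
  have sp: "space (N n) = space P" for n
    using sets by (rule sets_eq_imp_space_eq)
  have meas: "v \<in> borel_measurable (N n) \<longleftrightarrow> v \<in> borel_measurable P" for v :: "'a \<Rightarrow> ennreal" and n
    using measurable_cong_sets[OF sets refl] by blast
  \<comment> \<open>Finite-valued simple functions are chosen because multiplication by
    \<open>top\<close> is not continuous at 0 in \<open>ennreal\<close>.\<close>
  have "(\<integral>\<^sup>+x. u x \<partial>P) = (SUP s \<in> {g. simple_function P g \<and> g \<le> u \<and> (\<forall>x. g x < top)}. integral\<^sup>S P s)"
    by (rule nn_integral_def_finite)
  also have "\<dots> \<le> liminf (\<lambda>n. \<integral>\<^sup>+x. u x \<partial>N n)"
  proof (rule SUP_least, clarify)
    fix s assume s: "simple_function P s" "s \<le> u" "\<forall>x. s x < top"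
    then have sN: "simple_function (N n) s" for n
      using simple_function_cong_algebra[OF sets sp] by blast
    have "(\<lambda>n. integral\<^sup>S (N n) s) \<longlonglongrightarrow> integral\<^sup>S P s"
      unfolding simple_integral_def sp
    proof (intro tendsto_sum)
      fix y assume "y \<in> s ` space P"
      then have "y < top"
        using s(3) by auto
      moreover have "s -` {y} \<inter> space P \<in> sets P"
        using simple_functionD(2)[OF s(1)] .
      ultimately show "(\<lambda>n. y * emeasure (N n) (s -` {y} \<inter> space P)) \<longlonglongrightarrow>
          y * emeasure P (s -` {y} \<inter> space P)"
        using lim by (intro ennreal_tendsto_cmult)
    qed
    then have "integral\<^sup>S P s = liminf (\<lambda>n. integral\<^sup>S (N n) s)"
      by (metis lim_imp_Liminf sequentially_bot)
    also have "\<dots> \<le> liminf (\<lambda>n. \<integral>\<^sup>+x. u x \<partial>N n)"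
      using sN s(2)
      by (intro Liminf_mono always_eventually allI)
        (auto simp flip: nn_integral_eq_simple_integral intro!: nn_integral_mono simp: le_fun_def)
    finally show "integral\<^sup>S P s \<le> liminf (\<lambda>n. \<integral>\<^sup>+x. u x \<partial>N n)" .
  qed
  finally show ?thesis .
qed

text \<open>In the slicing formula, first the outer measure and then the measure of the slices is
  enlarged. This supplies the common majorant for the product measures.\<close>

lemma pair_measure_mono:
  assumes "sets N = sets M" "N \<le> M" "finite_measure M"
  shows "N \<Otimes>\<^sub>M N \<le> M \<Otimes>\<^sub>M M"
proof -
  have N: "finite_measure N"
    by (rule finite_measure_mono_measure[OF assms(3,1,2)])
  interpret N: finite_measure N by fact
  interpret M: finite_measure M by fact
  have s: "sets (N \<Otimes>\<^sub>M N) = sets (M \<Otimes>\<^sub>M M)"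
    using assms(1) by (intro sets_pair_measure_cong)
  have "emeasure (N \<Otimes>\<^sub>M N) A \<le> emeasure (M \<Otimes>\<^sub>M M) A" if A: "A \<in> sets (M \<Otimes>\<^sub>M M)" for A
  proof -
    have "emeasure (N \<Otimes>\<^sub>M N) A = (\<integral>\<^sup>+x. emeasure N (Pair x -` A) \<partial>N)"
      using A s by (intro N.emeasure_pair_measure_alt) simp
    also have "\<dots> \<le> (\<integral>\<^sup>+x. emeasure N (Pair x -` A) \<partial>M)"
      using assms by (intro nn_integral_mono_measure)
    also have "\<dots> \<le> (\<integral>\<^sup>+x. emeasure M (Pair x -` A) \<partial>M)"
      using le_measure[OF assms(1)] assms(1,2) sets_Pair1[OF A] by (intro nn_integral_mono) auto
    also have "\<dots> = emeasure (M \<Otimes>\<^sub>M M) A"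
      using A by (intro M.emeasure_pair_measure_alt[symmetric])
    finally show ?thesis .
  qed
  then show ?thesis
    by (simp add: le_measure s)
qed

text \<open>On rectangles the product measures converge, being products of convergent finite values.
  Rectangles are an intersection-stable generator and \<open>M \<Otimes>\<^sub>M M\<close> is a
  majorant, so a setwise limit \<open>Q\<close> exists on the whole product sigma-algebra; agreement
  on rectangles identifies it with \<open>P \<Otimes>\<^sub>M P\<close>.\<close>

lemma pair_measure_setwise:
  fixes M P :: "'a measure" and N :: "nat \<Rightarrow> 'a measure"
  assumes M: "finite_measure M"
    and sets: "\<And>n. sets (N n) = sets M" and le: "\<And>n. N n \<le> M"
    and P: "sets P = sets M" "P \<le> M"
    and lim: "\<And>A. A \<in> sets M \<Longrightarrow> (\<lambda>n. emeasure (N n) A) \<longlonglongrightarrow> emeasure P A"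
    and A: "A \<in> sets (M \<Otimes>\<^sub>M M)"
  shows "(\<lambda>n. emeasure (N n \<Otimes>\<^sub>M N n) A) \<longlonglongrightarrow> emeasure (P \<Otimes>\<^sub>M P) A"
proof -
  interpret M: finite_measure M by fact
  interpret P: finite_measure P
    by (rule finite_measure_mono_measure[OF M P])
  have N: "finite_measure (N n)" for n
    by (rule finite_measure_mono_measure[OF M sets le])
  interpret MM: finite_measure "M \<Otimes>\<^sub>M M"
    by (rule finite_measure_pair_measure) fact+
  have NN: "finite_measure (N n \<Otimes>\<^sub>M N n)" for n
    using N by (intro finite_measure_pair_measure)
  let ?G = "{a \<times> b |a b. a \<in> sets M \<and> b \<in> sets M}"
  have ss: "sets (N n \<Otimes>\<^sub>M N n) = sets (M \<Otimes>\<^sub>M M)" for n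
    using sets by (intro sets_pair_measure_cong)
  have rect: "(\<lambda>n. emeasure (N n \<Otimes>\<^sub>M N n) (a \<times> b)) \<longlonglongrightarrow> emeasure P a * emeasure P b"
    if ab: "a \<in> sets M" "b \<in> sets M" for a b
  proof -
    have "emeasure (N n \<Otimes>\<^sub>M N n) (a \<times> b) = emeasure (N n) a * emeasure (N n) b" for n
      using ab N[of n] by (intro sigma_finite_measure.emeasure_pair_measure_Times)
        (auto simp: sets intro: finite_measure.axioms)
    then show ?thesis
      using lim ab by (simp) (intro tendsto_mult_ennreal; auto)
  qed
  have conv: "convergent (\<lambda>n. measure (N n \<Otimes>\<^sub>M N n) B)" if B: "B \<in> ?G" for B
  proof -
    obtain a b where ab: "B = a \<times> b" "a \<in> sets M" "b \<in> sets M"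
      using B by blast
    have "(\<lambda>n. enn2real (emeasure (N n \<Otimes>\<^sub>M N n) B)) \<longlonglongrightarrow> enn2real (emeasure P a * emeasure P b)"
      unfolding ab(1) P.emeasure_eq_measure using rect[OF ab(2,3)]
      by (intro tendsto_enn2real) (simp_all add: P.emeasure_eq_measure flip: ennreal_mult)
    then show ?thesis
      by (auto simp: convergent_def measure_def)
  qed
  have G1: "?G \<subseteq> Pow (space (M \<Otimes>\<^sub>M M))"
    using sets.sets_into_space by (fastforce simp: space_pair_measure)
  have G2: "sets (M \<Otimes>\<^sub>M M) = sigma_sets (space (M \<Otimes>\<^sub>M M)) ?G"
    by (simp add: sets_pair_measure space_pair_measure)
  have G3: "space (M \<Otimes>\<^sub>M M) \<in> ?G"
    unfolding space_pair_measure by blast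
  obtain Q where Q: "sets Q = sets (M \<Otimes>\<^sub>M M)" "Q \<le> M \<Otimes>\<^sub>M M"
    "\<And>A. A \<in> sets (M \<Otimes>\<^sub>M M) \<Longrightarrow> (\<lambda>n. emeasure (N n \<Otimes>\<^sub>M N n) A) \<longlonglongrightarrow> emeasure Q A"
    by (rule setwise_limit_exists[OF MM.finite_measure_axioms ss pair_measure_mono[OF sets le M]
        Int_stable_pair_measure_generator G1 G2 G3 conv]) (assumption | rule that)+
  have "P \<Otimes>\<^sub>M P = Q"
  proof (rule pair_measure_eqI)
    show "sets (P \<Otimes>\<^sub>M P) = sets Q"
      unfolding Q(1) using P(1) by (intro sets_pair_measure_cong)
    fix a b assume "a \<in> sets P" "b \<in> sets P"
    then show "emeasure P a * emeasure P b = emeasure Q (a \<times> b)"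
      using LIMSEQ_unique[OF rect Q(3)] P(1) by (metis pair_measureI)
  qed unfold_locales
  then show ?thesis
    using Q(3) A by simp
qed

section \<open>Countable generators of Borel sigma-algebras\<close>

text \<open>Finite intersections of members of a countable base; the empty intersection supplies
  \<open>UNIV\<close>. The diagonal argument runs over such a generator.\<close>

lemma borel_countable_Int_stable_generator:
  obtains G :: "'a :: second_countable_topology set set"
  where "countable G" "Int_stable G" "UNIV \<in> G" "sets borel = sigma_sets UNIV G"
proof -
  obtain B :: "'a set set" where B: "countable B" "topological_basis B"
    using ex_countable_basis by blast
  define G where "G = Inter ` {F. finite F \<and> F \<subseteq> B}"
  have "countable G"
    unfolding G_def using B(1)
    by (intro countable_image) (metis (no_types, lifting) Collect_cong conj_commute countable_Collect_finite_subset)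
  moreover have "Int_stable G"
  proof (rule Int_stableI)
    fix a b assume "a \<in> G" "b \<in> G"
    then obtain F F' where "a = \<Inter>F" "b = \<Inter>F'" "finite F" "finite F'" "F \<subseteq> B" "F' \<subseteq> B"
      by (auto simp: G_def)
    then show "a \<inter> b \<in> G"
      unfolding G_def by (intro image_eqI[where x = "F \<union> F'"]) auto
  qed
  moreover have "UNIV \<in> G"
    unfolding G_def by (intro image_eqI[where x = "{}"]) auto
  moreover have "sets borel = sigma_sets UNIV G"
  proof
    have "B \<subseteq> G"
    proof
      fix b assume "b \<in> B"
      then show "b \<in> G"
        unfolding G_def by (intro image_eqI[where x = "{b}"]) auto
    qed
    then show "sets borel \<subseteq> sigma_sets UNIV G"
      unfolding borel_eq_countable_basis[OF B] by (simp add: sigma_sets_mono')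
    have "open a" if "a \<in> G" for a
      using that B(2) topological_basis_open by (fastforce simp: G_def intro!: open_Inter)
    then have "G \<subseteq> sets borel"
      by auto
    then show "sigma_sets UNIV G \<subseteq> sets borel"
      using sets.sigma_sets_subset[of G borel] by simp
  qed
  ultimately show thesis
    by (rule that)
qed

lemma restrict_borel_countable_Int_stable_generator:
  fixes K :: "'a :: second_countable_topology set"
  obtains G where "countable G" "Int_stable G" "G \<subseteq> Pow K" "K \<in> G"
    "sets (restrict_space borel K) = sigma_sets K G"
proof -
  obtain G :: "'a set set" where G: "countable G" "Int_stable G" "UNIV \<in> G" "sets borel = sigma_sets UNIV G"
    by (rule borel_countable_Int_stable_generator)
  show thesis
  proof (rule that[of "(\<inter>) K ` G"])
    show "Int_stable ((\<inter>) K ` G)"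
    proof (rule Int_stableI)
      fix a b assume "a \<in> (\<inter>) K ` G" "b \<in> (\<inter>) K ` G"
      then obtain a' b' where "a = K \<inter> a'" "b = K \<inter> b'" "a' \<in> G" "b' \<in> G"
        by auto
      then show "a \<inter> b \<in> (\<inter>) K ` G"
        using Int_stableD[OF G(2)] by (intro image_eqI[where x = "a' \<inter> b'"]) auto
    qed
    show "sets (restrict_space borel K) = sigma_sets K ((\<inter>) K ` G)"
    proof -
      have "sets (restrict_space borel K) = (\<inter>) K ` sigma_sets UNIV G"
        by (simp add: sets_restrict_space G(4))
      \<comment> \<open>Traces on \<open>K\<close> are written as preimages under the identity
        because generating a sigma-algebra commutes with preimages.\<close>
      also have "\<dots> = {(\<lambda>x. x) -` A \<inter> K |A. A \<in> sigma_sets UNIV G}"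
        by auto
      also have "\<dots> = sigma_sets K {(\<lambda>x. x) -` A \<inter> K |A. A \<in> G}"
        by (rule sigma_sets_vimage_commute) auto
      also have "{(\<lambda>x. x) -` A \<inter> K |A. A \<in> G} = (\<inter>) K ` G"
        by auto
      finally show ?thesis .
    qed
  qed (use G in auto)
qed

section \<open>Limits of extended real and of bounded integrals\<close>

text \<open>\<open>enn2ereal\<close> is continuous and monotone, hence commutes with lower limits.
  Energies take values in \<open>ereal\<close> and need the Fatou inequality in this form.\<close>

lemma enn2ereal_nn_integral_liminf_setwise:
  fixes N :: "nat \<Rightarrow> 'a measure" and u :: "'a \<Rightarrow> ennreal"
  assumes "u \<in> borel_measurable P" "\<And>n. sets (N n) = sets P"
    "\<And>A. A \<in> sets P \<Longrightarrow> (\<lambda>n. emeasure (N n) A) \<longlonglongrightarrow> emeasure P A"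
  shows "enn2ereal (\<integral>\<^sup>+x. u x \<partial>P) \<le> liminf (\<lambda>n. enn2ereal (\<integral>\<^sup>+x. u x \<partial>N n))"
proof -
  have mono: "mono enn2ereal"
    by (rule monoI) (simp add: less_eq_ennreal.rep_eq)
  have "enn2ereal (\<integral>\<^sup>+x. u x \<partial>P) \<le> enn2ereal (liminf (\<lambda>n. \<integral>\<^sup>+x. u x \<partial>N n))"
    by (intro monoD[OF mono] nn_integral_liminf_setwise assms)
  also have "\<dots> = liminf (\<lambda>n. enn2ereal (\<integral>\<^sup>+x. u x \<partial>N n))"
    by (rule Liminf_compose_continuous_mono[OF continuous_on_enn2ereal mono, symmetric]) simp
  finally show ?thesis .
qed

text \<open>The Fatou inequality for the nonnegative functions \<open>b + \<phi>\<close> and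
  \<open>b - \<phi>\<close> controls the lower and the upper limit; the contribution of
  \<open>b\<close> cancels because the total masses converge.\<close>

lemma integral_tendsto_setwise:
  fixes N :: "nat \<Rightarrow> 'a measure" and \<phi> :: "'a \<Rightarrow> real"
  assumes \<phi>: "\<phi> \<in> borel_measurable P" and b: "\<And>x. x \<in> space P \<Longrightarrow> \<bar>\<phi> x\<bar> \<le> b"
    and fin: "finite_measure P" "\<And>n. finite_measure (N n)" and sets: "\<And>n. sets (N n) = sets P"
    and lim: "\<And>A. A \<in> sets P \<Longrightarrow> (\<lambda>n. emeasure (N n) A) \<longlonglongrightarrow> emeasure P A"
  shows "(\<lambda>n. integral\<^sup>L (N n) \<phi>) \<longlonglongrightarrow> integral\<^sup>L P \<phi>"
proof -
  have sp: "space (N n) = space P" for n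
    using sets by (rule sets_eq_imp_space_eq)
  have lower: "ereal (integral\<^sup>L P \<psi>) \<le> liminf (\<lambda>n. ereal (integral\<^sup>L (N n) \<psi>))"
    if \<psi>: "\<psi> \<in> borel_measurable P" "\<And>x. x \<in> space P \<Longrightarrow> \<bar>\<psi> x\<bar> \<le> b" for \<psi> :: "'a \<Rightarrow> real"
  proof -
    have shift: "enn2ereal (\<integral>\<^sup>+x. ennreal (\<psi> x + b) \<partial>Q) = ereal (b * measure Q (space Q)) + ereal (integral\<^sup>L Q \<psi>)"
      if Q: "sets Q = sets P" "finite_measure Q" for Q
    proof -
      interpret Q: finite_measure Q by fact
      have sQ: "space Q = space P"
        using Q(1) by (rule sets_eq_imp_space_eq)
      have m: "\<psi> \<in> borel_measurable Q"
        using \<psi>(1) measurable_cong_sets[OF Q(1) refl] by blast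
      have int: "integrable Q \<psi>"
        using \<psi>(2) m by (intro Q.integrable_const_bound[where B = b]) (auto simp: sQ)
      have nonneg: "0 \<le> \<psi> x + b" if "x \<in> space Q" for x
        using \<psi>(2)[of x] that by (auto simp: sQ abs_le_iff)
      have "(\<integral>\<^sup>+x. ennreal (\<psi> x + b) \<partial>Q) = ennreal (\<integral>x. \<psi> x + b \<partial>Q)"
        using int nonneg by (intro nn_integral_eq_integral) auto
      moreover have "0 \<le> (\<integral>x. \<psi> x + b \<partial>Q)"
        using nonneg by (intro Bochner_Integration.integral_nonneg) auto
      moreover have "(\<integral>x. \<psi> x + b \<partial>Q) = b * measure Q (space Q) + integral\<^sup>L Q \<psi>"
        using int by simp
      ultimately show ?thesis
        by simp
    qed
    have m: "(\<lambda>n. measure (N n) (space P)) \<longlonglongrightarrow> measure P (space P)"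
      using lim[OF sets.top] fin(1) unfolding measure_def
      by (intro tendsto_enn2real) (simp_all add: finite_measure.emeasure_eq_measure)
    have "ereal (b * measure P (space P)) + ereal (integral\<^sup>L P \<psi>)
        \<le> liminf (\<lambda>n. ereal (b * measure (N n) (space P)) + ereal (integral\<^sup>L (N n) \<psi>))"
      using enn2ereal_nn_integral_liminf_setwise[of "\<lambda>x. ennreal (\<psi> x + b)" P N] sets lim \<psi>(1) fin
      by (simp add: shift sp)
    also have "\<dots> = ereal (b * measure P (space P)) + liminf (\<lambda>n. ereal (integral\<^sup>L (N n) \<psi>))"
      using m by (intro ereal_liminf_lim_add) (auto intro!: tendsto_intros)
    finally show ?thesis
      by (cases "liminf (\<lambda>n. ereal (integral\<^sup>L (N n) \<psi>))") auto
  qed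
  have "ereal (- integral\<^sup>L P \<phi>) \<le> liminf (\<lambda>n. ereal (- integral\<^sup>L (N n) \<phi>))"
    using lower[of "\<lambda>x. - \<phi> x"] \<phi> b by simp
  then have "limsup (\<lambda>n. ereal (integral\<^sup>L (N n) \<phi>)) \<le> ereal (integral\<^sup>L P \<phi>)"
    using ereal_Liminf_uminus[of sequentially "\<lambda>n. ereal (integral\<^sup>L (N n) \<phi>)"]
    by (simp add: ereal_uminus_le_reorder flip: uminus_ereal.simps)
  then show ?thesis
    using lower[OF \<phi> b] by (rule limsup_le_liminf_real)
qed

text \<open>Otherwise infinitely many terms avoid a neighbourhood of \<open>L\<close>, and the
  subsequence enumerating them contradicts the assumption. It turns compactness plus uniqueness of
  the limit into convergence of the full sequence.\<close>

lemma tendsto_if_subseq_tendsto: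
  fixes X :: "nat \<Rightarrow> 'a :: topological_space"
  assumes "\<And>r :: nat \<Rightarrow> nat. strict_mono r \<Longrightarrow> \<exists>s :: nat \<Rightarrow> nat. strict_mono s \<and> (\<lambda>n. X (r (s n))) \<longlonglongrightarrow> L"
  shows "X \<longlonglongrightarrow> L"
proof (rule ccontr)
  assume "\<not> X \<longlonglongrightarrow> L"
  then obtain S where S: "open S" "L \<in> S" "\<not> (\<forall>\<^sub>F n in sequentially. X n \<in> S)"
    by (auto simp: tendsto_def)
  then have "infinite {n. X n \<notin> S}"
    by (simp add: eventually_cofinite flip: cofinite_eq_sequentially)
  then obtain r :: "nat \<Rightarrow> nat" where r: "strict_mono r" "\<And>n. X (r n) \<notin> S"
    using infinite_enumerate by blast
  obtain s where "(\<lambda>n. X (r (s n))) \<longlonglongrightarrow> L"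
    using assms[OF r(1)] by blast
  from topological_tendstoD[OF this S(1,2)] r(2) show False
    by simp
qed

section \<open>Reduction to integrals of nonnegative functions\<close>

lemma ereal_integral_nonneg:
  assumes "\<And>x. x \<in> space M \<Longrightarrow> 0 \<le> f x"
  shows "ereal_integral M f = enn2ereal (\<integral>\<^sup>+x. e2ennreal (f x) \<partial>M)"
proof -
  have "(\<integral>\<^sup>+x. e2ennreal (- f x) \<partial>M) = (\<integral>\<^sup>+x. 0 \<partial>M)"
    using assms by (intro nn_integral_cong) (simp add: e2ennreal_neg)
  then show ?thesis
    by (simp add: ereal_integral_def zero_ennreal.rep_eq)
qed

text \<open>Integrate the pointwise identity (f + c)^+ + f^- = f^+ + c, valid where f >= -c. Stated
  with sums only, it avoids subtracting infinities.\<close>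

lemma ereal_integral_add_const:
  assumes "finite_measure M" and f: "f \<in> borel_measurable M"
    and c: "0 \<le> c" "\<And>x. x \<in> space M \<Longrightarrow> - ereal c \<le> f x"
  shows "ereal_integral M f
    = enn2ereal (\<integral>\<^sup>+x. e2ennreal (f x + ereal c) \<partial>M) - ereal (c * measure M (space M))"
proof -
  interpret finite_measure M by fact
  let ?A = "\<integral>\<^sup>+x. e2ennreal (f x) \<partial>M" and ?B = "\<integral>\<^sup>+x. e2ennreal (- f x) \<partial>M"
    and ?C = "\<integral>\<^sup>+x. e2ennreal (f x + ereal c) \<partial>M"
  have m: "(\<lambda>x. e2ennreal (f x)) \<in> borel_measurable M" "(\<lambda>x. e2ennreal (- f x)) \<in> borel_measurable M"
    "(\<lambda>x. e2ennreal (f x + ereal c)) \<in> borel_measurable M"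
    using f by measurable
  have pt: "e2ennreal (f x + ereal c) + e2ennreal (- f x) = e2ennreal (f x) + ennreal c"
    if "x \<in> space M" for x
  proof (cases "f x")
    case (real r)
    then have "- c \<le> r"
      using c(2)[OF that] by simp
    then show ?thesis
      using c(1) real by (cases "0 \<le> r") (simp_all add: ennreal_neg ennreal_plus[symmetric] del: ennreal_plus)
  qed (use c(2)[OF that] in \<open>auto simp: e2ennreal_neg\<close>)
  have "?C + ?B = (\<integral>\<^sup>+x. e2ennreal (f x + ereal c) + e2ennreal (- f x) \<partial>M)"
    using m by (simp add: nn_integral_add)
  also have "\<dots> = (\<integral>\<^sup>+x. e2ennreal (f x) + ennreal c \<partial>M)"
    using pt by (rule nn_integral_cong)
  also have "\<dots> = ?A + ennreal (c * measure M (space M))"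
    using m c(1) by (simp add: nn_integral_add emeasure_eq_measure ennreal_mult)
  finally have eq: "enn2ereal ?C + enn2ereal ?B = enn2ereal ?A + ereal (c * measure M (space M))"
    using c(1) by (simp flip: plus_ennreal.rep_eq add: plus_ennreal.rep_eq)
  \<comment> \<open>The negative part is at most \<open>c\<close>, so its integral is finite and can
    be moved across the equation even if the other integrals are infinite.\<close>
  have "?B \<le> (\<integral>\<^sup>+x. ennreal c \<partial>M)"
  proof (rule nn_integral_mono)
    fix x assume "x \<in> space M"
    then have "- f x \<le> ereal c"
      using c(2) by (simp add: ereal_uminus_le_reorder)
    then show "e2ennreal (- f x) \<le> ennreal c"
      using e2ennreal_mono by fastforce
  qed
  also have "\<dots> < \<infinity>"
    by (simp add: emeasure_eq_measure ennreal_mult_less_top)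
  finally obtain b where "enn2ereal ?B = ereal b"
    by (cases ?B) auto
  then show ?thesis
    using eq unfolding ereal_integral_def
    by (cases "enn2ereal ?A"; cases "enn2ereal ?C") auto
qed

subsection \<open>Harmonic functions\<close>

lemma harmonic_onE:
  assumes "harmonic_on S u"
  obtains ux uy uxx uxy uyx uyy where
    "\<And>z. z \<in> S \<Longrightarrow> (u has_derivative (\<lambda>h. ux z * Re h + uy z * Im h)) (at z)"
    "\<And>z. z \<in> S \<Longrightarrow> (ux has_derivative (\<lambda>h. uxx z * Re h + uxy z * Im h)) (at z)"
    "\<And>z. z \<in> S \<Longrightarrow> (uy has_derivative (\<lambda>h. uyx z * Re h + uyy z * Im h)) (at z)"
    "continuous_on S uxx" "continuous_on S uxy" "continuous_on S uyx" "continuous_on S uyy"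
    "\<And>z. z \<in> S \<Longrightarrow> uxx z + uyy z = 0"
  using assms unfolding harmonic_on_def by blast

lemma harmonic_onI:
  assumes "open S"
    "\<And>z. z \<in> S \<Longrightarrow> (u has_derivative (\<lambda>h. ux z * Re h + uy z * Im h)) (at z)"
    "\<And>z. z \<in> S \<Longrightarrow> (ux has_derivative (\<lambda>h. uxx z * Re h + uxy z * Im h)) (at z)"
    "\<And>z. z \<in> S \<Longrightarrow> (uy has_derivative (\<lambda>h. uyx z * Re h + uyy z * Im h)) (at z)"
    "continuous_on S uxx" "continuous_on S uxy" "continuous_on S uyx" "continuous_on S uyy"
    "\<And>z. z \<in> S \<Longrightarrow> uxx z + uyy z = 0"
  shows "harmonic_on S u"
  unfolding harmonic_on_def using assms by blast

lemma harmonic_on_open: "harmonic_on S u \<Longrightarrow> open S"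
  by (simp add: harmonic_on_def)

lemma harmonic_on_imp_continuous_on: "harmonic_on S u \<Longrightarrow> continuous_on S u"
  by (metis harmonic_onE has_derivative_continuous continuous_at_imp_continuous_on)

lemma harmonic_on_subset:
  assumes "harmonic_on S u" "open T" "T \<subseteq> S"
  shows "harmonic_on T u"
  using assms(1)
proof (rule harmonic_onE)
  fix ux uy uxx uxy uyx uyy
  assume u: "\<And>z. z \<in> S \<Longrightarrow> (u has_derivative (\<lambda>h. ux z * Re h + uy z * Im h)) (at z)"
    "\<And>z. z \<in> S \<Longrightarrow> (ux has_derivative (\<lambda>h. uxx z * Re h + uxy z * Im h)) (at z)"
    "\<And>z. z \<in> S \<Longrightarrow> (uy has_derivative (\<lambda>h. uyx z * Re h + uyy z * Im h)) (at z)"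
    "continuous_on S uxx" "continuous_on S uxy" "continuous_on S uyx" "continuous_on S uyy"
    "\<And>z. z \<in> S \<Longrightarrow> uxx z + uyy z = 0"
  show ?thesis
    by (rule harmonic_onI[OF assms(2) u(1-3) u(4-7)[THEN continuous_on_subset, OF assms(3)] u(8)])
      (use assms(3) in blast)+
qed

lemma harmonic_on_cong:
  assumes "harmonic_on S u" "\<And>z. z \<in> S \<Longrightarrow> u z = v z"
  shows "harmonic_on S v"
proof -
  have S: "open S"
    using assms(1) by (rule harmonic_on_open)
  show ?thesis
    using assms(1)
  proof (rule harmonic_onE)
    fix ux uy uxx uxy uyx uyy
    assume *: "\<And>z. z \<in> S \<Longrightarrow> (u has_derivative (\<lambda>h. ux z * Re h + uy z * Im h)) (at z)"
      "\<And>z. z \<in> S \<Longrightarrow> (ux has_derivative (\<lambda>h. uxx z * Re h + uxy z * Im h)) (at z)"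
      "\<And>z. z \<in> S \<Longrightarrow> (uy has_derivative (\<lambda>h. uyx z * Re h + uyy z * Im h)) (at z)"
      "continuous_on S uxx" "continuous_on S uxy" "continuous_on S uyx" "continuous_on S uyy"
      "\<And>z. z \<in> S \<Longrightarrow> uxx z + uyy z = 0"
    have "(v has_derivative (\<lambda>h. ux z * Re h + uy z * Im h)) (at z)" if "z \<in> S" for z
      using has_derivative_transform_within_open[OF *(1)[OF that] S that] assms(2) by blast
    then show ?thesis
      by (rule harmonic_onI[OF S _ *(2-8)])
  qed
qed

lemma harmonic_on_add:
  assumes "harmonic_on S u" "harmonic_on S v"
  shows "harmonic_on S (\<lambda>z. u z + v z)"
  using assms(1)
proof (rule harmonic_onE)
  fix ux uy uxx uxy uyx uyy
  assume u: "\<And>z. z \<in> S \<Longrightarrow> (u has_derivative (\<lambda>h. ux z * Re h + uy z * Im h)) (at z)"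
    "\<And>z. z \<in> S \<Longrightarrow> (ux has_derivative (\<lambda>h. uxx z * Re h + uxy z * Im h)) (at z)"
    "\<And>z. z \<in> S \<Longrightarrow> (uy has_derivative (\<lambda>h. uyx z * Re h + uyy z * Im h)) (at z)"
    "continuous_on S uxx" "continuous_on S uxy" "continuous_on S uyx" "continuous_on S uyy"
    "\<And>z. z \<in> S \<Longrightarrow> uxx z + uyy z = 0"
  show ?thesis
    using assms(2)
  proof (rule harmonic_onE)
    fix vx vy vxx vxy vyx vyy
    assume v: "\<And>z. z \<in> S \<Longrightarrow> (v has_derivative (\<lambda>h. vx z * Re h + vy z * Im h)) (at z)"
      "\<And>z. z \<in> S \<Longrightarrow> (vx has_derivative (\<lambda>h. vxx z * Re h + vxy z * Im h)) (at z)"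
      "\<And>z. z \<in> S \<Longrightarrow> (vy has_derivative (\<lambda>h. vyx z * Re h + vyy z * Im h)) (at z)"
      "continuous_on S vxx" "continuous_on S vxy" "continuous_on S vyx" "continuous_on S vyy"
      "\<And>z. z \<in> S \<Longrightarrow> vxx z + vyy z = 0"
    show ?thesis
    proof (rule harmonic_onI[where ux = "\<lambda>z. ux z + vx z" and uy = "\<lambda>z. uy z + vy z"
          and uxx = "\<lambda>z. uxx z + vxx z" and uxy = "\<lambda>z. uxy z + vxy z"
          and uyx = "\<lambda>z. uyx z + vyx z" and uyy = "\<lambda>z. uyy z + vyy z"])
      fix z assume z: "z \<in> S"
      show "((\<lambda>z. u z + v z) has_derivative (\<lambda>h. (ux z + vx z) * Re h + (uy z + vy z) * Im h)) (at z)"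
        using has_derivative_add[OF u(1)[OF z] v(1)[OF z]] by (simp add: algebra_simps)
      show "((\<lambda>z. ux z + vx z) has_derivative (\<lambda>h. (uxx z + vxx z) * Re h + (uxy z + vxy z) * Im h)) (at z)"
        using has_derivative_add[OF u(2)[OF z] v(2)[OF z]] by (simp add: algebra_simps)
      show "((\<lambda>z. uy z + vy z) has_derivative (\<lambda>h. (uyx z + vyx z) * Re h + (uyy z + vyy z) * Im h)) (at z)"
        using has_derivative_add[OF u(3)[OF z] v(3)[OF z]] by (simp add: algebra_simps)
      show "uxx z + vxx z + (uyy z + vyy z) = 0"
        using u(8)[OF z] v(8)[OF z] by simp
    qed (rule harmonic_on_open[OF assms(1)] continuous_on_add u v)+
  qed
qed

text \<open>Here \<open>f\<close> is the complex gradient \<open>ux - i uy\<close> of \<open>u\<close>.\<close>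

lemma harmonic_on_complex_gradient:
  assumes "open S"
    and u: "\<And>z. z \<in> S \<Longrightarrow> (u has_derivative (\<lambda>h. Re (f z * h))) (at z)"
    and f: "\<And>z. z \<in> S \<Longrightarrow> (f has_field_derivative f' z) (at z)"
    and f': "continuous_on S f'"
  shows "harmonic_on S u"
proof (rule harmonic_onI[OF assms(1), where ux = "\<lambda>z. Re (f z)" and uy = "\<lambda>z. - Im (f z)"
      and uxx = "\<lambda>z. Re (f' z)" and uxy = "\<lambda>z. - Im (f' z)"
      and uyx = "\<lambda>z. - Im (f' z)" and uyy = "\<lambda>z. - Re (f' z)"])
  fix z assume z: "z \<in> S"
  show "(u has_derivative (\<lambda>h. Re (f z) * Re h + - Im (f z) * Im h)) (at z)"
    using u[OF z] by simp
  have f: "(f has_derivative (\<lambda>h. f' z * h)) (at z)"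
    using f[OF z] by (simp add: has_field_derivative_def)
  show "((\<lambda>z. Re (f z)) has_derivative (\<lambda>h. Re (f' z) * Re h + - Im (f' z) * Im h)) (at z)"
    using has_derivative_Re[OF f] by simp
  show "((\<lambda>z. - Im (f z)) has_derivative (\<lambda>h. - Im (f' z) * Re h + - Re (f' z) * Im h)) (at z)"
    using has_derivative_minus[OF has_derivative_Im[OF f]] by (simp add: algebra_simps)
qed (use f' in \<open>auto intro!: continuous_intros\<close>)

lemma harmonic_on_const: "open S \<Longrightarrow> harmonic_on S (\<lambda>z. c)"
  by (rule harmonic_on_complex_gradient[where f = "\<lambda>_. 0" and f' = "\<lambda>_. 0"])
    (auto intro!: derivative_eq_intros)

text \<open>The gradient of the norm is \<open>sgn z\<close>, so that of log |z| is z / |z|^2, whose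
  inner product with \<open>h\<close> is \<open>Re (h / z)\<close>: the complex gradient is 1 /
  z.\<close>

lemma ln_cmod_has_derivative:
  assumes "z \<noteq> (0::complex)"
  shows "((\<lambda>z. ln (cmod z)) has_derivative (\<lambda>h. Re (h / z))) (at z)"
proof -
  have "(norm has_derivative (\<lambda>h. inner h (sgn z))) (at z)"
    using has_derivative_norm[OF assms] by (simp add: inner_commute)
  from has_derivative_ln[OF _ this] assms
  have "((\<lambda>z. ln (cmod z)) has_derivative (\<lambda>h. inner h (sgn z) * inverse (cmod z))) (at z)"
    by (simp add: divide_inverse)
  also have "(\<lambda>h. inner h (sgn z) * inverse (cmod z)) = (\<lambda>h. Re (h / z))"
  proof
    fix h
    have "Re (h / z) = inner h z / (cmod z)\<^sup>2"
      by (simp add: Re_divide inner_complex_def cmod_power2)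
    then show "inner h (sgn z) * inverse (cmod z) = Re (h / z)"
      by (simp add: sgn_div_norm power2_eq_square field_simps)
  qed
  finally show ?thesis .
qed

text \<open>Affine arguments serve both charts: z - b in the plane, and 1 - b w in the chart w = 1/z
  at infinity. The factor \<open>s\<close> allows either sign.\<close>

lemma harmonic_on_ln_affine:
  "harmonic_on {z. b * z + c \<noteq> 0} (\<lambda>z. s * ln (cmod (b * z + c)))"
proof (rule harmonic_on_complex_gradient[where f = "\<lambda>z. of_real s * b / (b * z + c)"
      and f' = "\<lambda>z. - (of_real s * b\<^sup>2) / (b * z + c)\<^sup>2"])
  show "open {z. b * z + c \<noteq> 0}"
    by (intro open_Collect_neq continuous_intros)
  fix z assume z: "z \<in> {z. b * z + c \<noteq> 0}"
  have "((\<lambda>z. b * z + c) has_derivative (\<lambda>h. b * h)) (at z)"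
    by (auto intro!: derivative_eq_intros)
  from has_derivative_compose[OF this ln_cmod_has_derivative] z
  have "((\<lambda>z. s * ln (cmod (b * z + c))) has_derivative (\<lambda>h. s * Re (b * h / (b * z + c)))) (at z)"
    by (intro has_derivative_mult_right) simp
  then show "((\<lambda>z. s * ln (cmod (b * z + c))) has_derivative (\<lambda>h. Re (of_real s * b / (b * z + c) * h))) (at z)"
    by (simp add: mult.assoc Re_divide field_simps)
  show "((\<lambda>z. of_real s * b / (b * z + c)) has_field_derivative - (of_real s * b\<^sup>2) / (b * z + c)\<^sup>2) (at z)"
    using z by (auto intro!: derivative_eq_intros simp: power2_eq_square)
qed (auto intro!: continuous_intros)

text \<open>The competitor below is harmonic by different formulas near the old pole and away from
  it. Since \<open>harmonic_on\<close> asks for global partial derivatives, those from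
  \<open>S\<close> and \<open>T\<close> must be glued: first partials agree on the overlap by
  uniqueness of derivatives, and second partials agree because the overlap is open.\<close>

lemma harmonic_on_Un:
  assumes "harmonic_on S u" "harmonic_on T u"
  shows "harmonic_on (S \<union> T) u"
  using assms(1)
proof (rule harmonic_onE)
  fix ux uy uxx uxy uyx uyy
  assume u: "\<And>z. z \<in> S \<Longrightarrow> (u has_derivative (\<lambda>h. ux z * Re h + uy z * Im h)) (at z)"
    "\<And>z. z \<in> S \<Longrightarrow> (ux has_derivative (\<lambda>h. uxx z * Re h + uxy z * Im h)) (at z)"
    "\<And>z. z \<in> S \<Longrightarrow> (uy has_derivative (\<lambda>h. uyx z * Re h + uyy z * Im h)) (at z)"
    "continuous_on S uxx" "continuous_on S uxy" "continuous_on S uyx" "continuous_on S uyy"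
    "\<And>z. z \<in> S \<Longrightarrow> uxx z + uyy z = 0"
  show ?thesis
    using assms(2)
  proof (rule harmonic_onE)
    fix vx vy vxx vxy vyx vyy
    assume v: "\<And>z. z \<in> T \<Longrightarrow> (u has_derivative (\<lambda>h. vx z * Re h + vy z * Im h)) (at z)"
      "\<And>z. z \<in> T \<Longrightarrow> (vx has_derivative (\<lambda>h. vxx z * Re h + vxy z * Im h)) (at z)"
      "\<And>z. z \<in> T \<Longrightarrow> (vy has_derivative (\<lambda>h. vyx z * Re h + vyy z * Im h)) (at z)"
      "continuous_on T vxx" "continuous_on T vxy" "continuous_on T vyx" "continuous_on T vyy"
      "\<And>z. z \<in> T \<Longrightarrow> vxx z + vyy z = 0"
    have S: "open S" and T: "open T"
      using assms harmonic_on_open by blast+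
    have uniq: "a = a' \<and> b = b'"
      if "(w has_derivative (\<lambda>h. a * Re h + b * Im h)) (at z)"
        "(w has_derivative (\<lambda>h. a' * Re h + b' * Im h)) (at z)"
      for w :: "complex \<Rightarrow> real" and z a b a' b'
    proof -
      have "(\<lambda>h. a * Re h + b * Im h) = (\<lambda>h. a' * Re h + b' * Im h)"
        using that by (rule has_derivative_unique)
      \<comment> \<open>Evaluation at 1 and at the imaginary unit reads off the two
        coefficients.\<close>
      from fun_cong[OF this, of 1] fun_cong[OF this, of \<i>] show ?thesis
        by simp
    qed
    define J :: "(complex \<Rightarrow> real) \<Rightarrow> (complex \<Rightarrow> real) \<Rightarrow> complex \<Rightarrow> real"
      where "J p q z = (if z \<in> S then p z else q z)" for p q z
    have e1: "ux z = vx z" "uy z = vy z" if "z \<in> S" "z \<in> T" for z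
      using uniq[OF u(1) v(1)] that by blast+
    have glue: "(J p q has_derivative F) (at z)"
      if "z \<in> S \<Longrightarrow> (p has_derivative F) (at z)" "z \<in> T \<Longrightarrow> (q has_derivative F) (at z)"
        "\<And>w. w \<in> S \<Longrightarrow> w \<in> T \<Longrightarrow> p w = q w" "z \<in> S \<union> T" for p q F z
    proof (cases "z \<in> S")
      case True
      show ?thesis
        by (rule has_derivative_transform_within_open[OF that(1)[OF True] S True]) (simp add: J_def)
    next
      case False
      with that(4) have z: "z \<in> T" by simp
      show ?thesis
        by (rule has_derivative_transform_within_open[OF that(2)[OF z] T z]) (simp add: J_def that(3))
    qed
    have J1: "J ux vx z = vx z" "J uy vy z = vy z" if "z \<in> T" for z
      using e1 that by (auto simp: J_def)
    \<comment> \<open>On the open overlap \<open>vx\<close> and \<open>vy\<close> coincide with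
      \<open>ux\<close> and \<open>uy\<close>, hence inherit their derivatives.\<close>
    have vS: "(vx has_derivative (\<lambda>h. uxx z * Re h + uxy z * Im h)) (at z)"
      "(vy has_derivative (\<lambda>h. uyx z * Re h + uyy z * Im h)) (at z)" if "z \<in> S" "z \<in> T" for z
      using has_derivative_transform_within_open[OF u(2)[OF that(1)] open_Int[OF S T], of vx]
        has_derivative_transform_within_open[OF u(3)[OF that(1)] open_Int[OF S T], of vy] e1 that
      by auto
    have e2: "uxx z = vxx z" "uxy z = vxy z" "uyx z = vyx z" "uyy z = vyy z" if "z \<in> S" "z \<in> T" for z
      using uniq[OF vS(1)[OF that] v(2)[OF that(2)]] uniq[OF vS(2)[OF that] v(3)[OF that(2)]] by auto
    have cont: "continuous_on (S \<union> T) (J p q)"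
      if "continuous_on S p" "continuous_on T q" "\<And>w. w \<in> S \<Longrightarrow> w \<in> T \<Longrightarrow> p w = q w" for p q
    proof (rule continuous_on_open_Un[OF S T])
      show "continuous_on S (J p q)"
        by (rule continuous_on_eq[OF that(1)]) (simp add: J_def)
      show "continuous_on T (J p q)"
        by (rule continuous_on_eq[OF that(2)]) (simp add: J_def that(3))
    qed
    show ?thesis
    proof (rule harmonic_onI[where ux = "J ux vx" and uy = "J uy vy" and uxx = "J uxx vxx"
          and uxy = "J uxy vxy" and uyx = "J uyx vyx" and uyy = "J uyy vyy"])
      fix z assume z: "z \<in> S \<union> T"
      show "(u has_derivative (\<lambda>h. J ux vx z * Re h + J uy vy z * Im h)) (at z)"
        using z u(1) v(1) by (cases "z \<in> S") (auto simp: J_def)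
      have *: "J p q z = q z" if "z \<in> T" "\<And>w. w \<in> S \<Longrightarrow> w \<in> T \<Longrightarrow> p w = q w" for p q
        using that by (simp add: J_def)
      have **: "J p q z = p z" if "z \<in> S" for p q
        using that by (simp add: J_def)
      show "(J ux vx has_derivative (\<lambda>h. J uxx vxx z * Re h + J uxy vxy z * Im h)) (at z)"
        by (rule glue[OF _ _ _ z])
          (use u(2) v(2) e1 e2 in \<open>simp_all add: * ** \<close>)
      show "(J uy vy has_derivative (\<lambda>h. J uyx vyx z * Re h + J uyy vyy z * Im h)) (at z)"
        by (rule glue[OF _ _ _ z])
          (use u(3) v(3) e1 e2 in \<open>simp_all add: * ** \<close>)
      show "J uxx vxx z + J uyy vyy z = 0"
        using z u(8) v(8) by (auto simp: J_def)
    next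
      show "open (S \<union> T)"
        using S T by (rule open_Un)
      show "continuous_on (S \<union> T) (J uxx vxx)" "continuous_on (S \<union> T) (J uxy vxy)"
        "continuous_on (S \<union> T) (J uyx vyx)" "continuous_on (S \<union> T) (J uyy vyy)"
        using e2 by (intro cont u v; blast)+
    qed
  qed
qed

subsection \<open>Upper semicontinuity of the Green function\<close>

lemma openin_sphere_imp_open:
  assumes "openin sphere_topology D"
  shows "open {z. Some z \<in> D}"
proof -
  have "openin euclidean {z \<in> topspace euclidean. Some z \<in> D}"
    using openin_continuous_map_preimage[OF continuous_map_Some assms] .
  then show ?thesis
    by simp
qed

text \<open>Near \<open>a\<close> the competitor is \<open>h - log |z - a'| + \<epsilon>\<close>, where \<open>h\<close> is the regular part of
  \<open>g(\<sqdot>, a)\<close>; this is nonnegative because \<open>- log |z - a'|\<close> is large there.  Away from \<open>a\<close> the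
  constant \<open>\<epsilon>\<close> compensates the possible negativity of \<open>log |(z - a) / (z - a')|\<close>.\<close>

lemma green_function_shift_pole:
  assumes D: "openin sphere_topology D" and g: "green_function D g" and a: "Some a \<in> D"
  obtains \<delta> where "\<delta> > 0"
    "\<And>a' z. a' \<in> ball a \<delta> \<Longrightarrow> Some z \<in> D \<Longrightarrow> z \<noteq> a \<Longrightarrow> z \<noteq> a' \<Longrightarrow>
      g (Some z) (Some a') \<le> ereal (real_of_ereal (g (Some z) (Some a)) +
        ln (cmod (z - a)) - ln (cmod (z - a')) + cmod (a - a') / \<delta>)"
proof -
  define gr where "gr = (\<lambda>s. real_of_ereal (g s (Some a)))"
  have pos: "positive_harmonic_with_pole D (Some a) (\<lambda>s. g s (Some a))"
    using g a by (simp add: green_function_def)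
  have gr0: "0 \<le> gr s" if "s \<in> D" "s \<noteq> Some a" for s
    using pos that by (simp add: positive_harmonic_with_pole_def gr_def real_of_ereal_pos)
  have gharm: "sphere_harmonic_on (D - {Some a}) gr"
    using pos by (simp add: positive_harmonic_with_pole_def gr_def)
  obtain e0 h where e0: "e0 > 0" "harmonic_on (ball a e0) h"
    and gh: "\<And>z. z \<in> ball a e0 - {a} \<Longrightarrow> gr (Some z) = h z - ln (cmod (z - a))"
    using pos by (auto simp: positive_harmonic_with_pole_def log_pole_at_def gr_def)
  obtain e1 where e1: "e1 > 0" "ball a e1 \<subseteq> {z. Some z \<in> D}"
    using openin_sphere_imp_open[OF D] a open_contains_ball by blast
  have "isCont h a"
    using harmonic_on_imp_continuous_on[OF e0(2)] e0(1)
    by (simp add: continuous_on_eq_continuous_at)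
  then obtain d where d: "d > 0" "\<And>z. dist z a < d \<Longrightarrow> dist (h z) (h a) < 1"
    using zero_less_one unfolding continuous_at_eps_delta by blast
  \<comment> \<open>\<open>e0\<close> gives the representation of \<open>gr\<close> by
    \<open>h\<close>, \<open>e1\<close> stays inside \<open>D\<close>, and \<open>d\<close> gives h
    > h(a) - 1. For w and a' in the ball, |w - a'| is below 2 \<delta>, so the last bound gives log
    |w - a'| \<le> h(a) - 1 \<le> h(w).\<close>
  define \<delta> where "\<delta> = min (min e0 e1) (min d (exp (h a - 1) / 2))"
  have \<delta>: "\<delta> > 0" "ball a \<delta> \<subseteq> ball a e0" "ball a \<delta> \<subseteq> {z. Some z \<in> D}" "\<delta> \<le> d" "2 * \<delta> \<le> exp (h a - 1)"
    using e0 e1 d by (auto simp: \<delta>_def)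
  show thesis
  proof (rule that[OF \<delta>(1)])
    fix a' z
    assume a': "a' \<in> ball a \<delta>" and z: "Some z \<in> D" "z \<noteq> a" "z \<noteq> a'"
    show "g (Some z) (Some a') \<le> ereal (real_of_ereal (g (Some z) (Some a)) +
        ln (cmod (z - a)) - ln (cmod (z - a')) + cmod (a - a') / \<delta>)"
    proof (cases "a' = a")
      case True
      have "g (Some z) (Some a) = ereal (gr (Some z))"
        using pos z by (simp add: positive_harmonic_with_pole_def gr_def ereal_real' less_top)
      then show ?thesis
        by (simp add: True)
    next
      case False
      define \<epsilon> where "\<epsilon> = cmod (a - a') / \<delta>"
      \<comment> \<open>The value at \<open>a\<close> removes the singularity: the pole of
        \<open>gr\<close> cancels against log |z - a|. At infinity the logarithm of the quotient
        tends to 0.\<close>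
      define v where "v s = (if s = Some a then h a - ln (cmod (a - a')) + \<epsilon>
          else gr s + (case s of None \<Rightarrow> 0 | Some z \<Rightarrow> ln (cmod (z - a)) - ln (cmod (z - a'))) + \<epsilon>)" for s
      define U where "U s = (if s = Some a' then \<infinity> else ereal (v s))" for s
      have \<epsilon>: "\<epsilon> \<ge> 0"
        using \<delta>(1) by (simp add: \<epsilon>_def)
      have v_near: "v (Some w) = h w - ln (cmod (w - a')) + \<epsilon>" if "w \<in> ball a \<delta>" for w
        using gh[of w] that \<delta>(2) by (auto simp: v_def)
      have v_far: "v (Some w) = gr (Some w) + ln (cmod (w - a)) - ln (cmod (w - a')) + \<epsilon>" if "w \<noteq> a" for w
        using that by (simp add: v_def)
      have v_pos: "0 \<le> v s" if s: "s \<in> D - {Some a'}" for s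
      proof (cases s)
        case None
        then show ?thesis
          using gr0[of s] s \<epsilon> by (simp add: v_def)
      next
        case (Some w)
        show ?thesis
        proof (cases "w \<in> ball a \<delta>")
          case True
          have "cmod (w - a') \<le> cmod (w - a) + cmod (a - a')"
            by (metis diff_add_cancel add_diff_eq norm_triangle_ineq)
          also have "\<dots> \<le> exp (h a - 1)"
            using True a' \<delta>(5) by (simp add: dist_norm norm_minus_commute)
          finally have "ln (cmod (w - a')) \<le> h a - 1"
            using Some s by (metis Diff_iff exp_gt_zero exp_ln_iff ln_exp ln_le_cancel_iff right_minus_eq singletonI zero_less_norm_iff)
          moreover have "h a - 1 \<le> h w"
            using d(2)[of w] True \<delta>(4) by (auto simp: dist_real_def dist_commute)
          ultimately show ?thesis
            using v_near[OF True] \<epsilon> Some by simp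
        next
          case False
          then have far: "\<delta> \<le> cmod (w - a)" "w \<noteq> a"
            using \<delta>(1) by (auto simp: dist_norm norm_minus_commute)
          have wa': "0 < cmod (w - a')"
            using Some s by auto
          have "cmod (w - a') \<le> cmod (w - a) + cmod (a - a')"
            by (metis diff_add_cancel add_diff_eq norm_triangle_ineq)
          \<comment> \<open>Outside the ball \<delta> \<le> |w - a|, so |a - a'| = \<delta>
            \<epsilon> \<le> \<epsilon> |w - a|. Thus the logarithm of the quotient loses at most
            log (1 + \<epsilon>) \<le> \<epsilon>, which is what the added constant pays
            for.\<close>
          also have "cmod (a - a') = \<delta> * \<epsilon>"
            using \<delta>(1) by (simp add: \<epsilon>_def)
          also have "cmod (w - a) + \<delta> * \<epsilon> \<le> cmod (w - a) * (1 + \<epsilon>)"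
            using mult_right_mono[OF far(1) \<epsilon>] by (simp add: algebra_simps)
          finally have "ln (cmod (w - a')) \<le> ln (cmod (w - a) * (1 + \<epsilon>))"
            using wa' by (intro ln_mono) auto
          also have "\<dots> = ln (cmod (w - a)) + ln (1 + \<epsilon>)"
            using far \<epsilon> by (intro ln_mult_pos) auto
          also have "ln (1 + \<epsilon>) \<le> \<epsilon>"
            using \<epsilon> by (rule ln_add_one_self_le_self)
          finally show ?thesis
            using v_far[OF far(2)] gr0[of s] s Some far by simp
        qed
      qed
      \<comment> \<open>On this radius |w b| < 1 for b = a and b = a', so the chart point 1/w meets
        neither pole.\<close>
      have nz: "w * b \<noteq> 1" if "w \<in> ball 0 (1 / (1 + cmod a + cmod a'))" "cmod b \<le> cmod a + cmod a'" for w b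
      proof
        assume "w * b = 1"
        then have "cmod w * cmod b = 1"
          by (metis norm_mult norm_one)
        moreover have "cmod w * cmod b \<le> cmod w * (1 + cmod a + cmod a')"
          using that(2) by (intro mult_left_mono) auto
        moreover have "cmod w * (1 + cmod a + cmod a') < 1"
          using that(1) by (simp add: field_simps add_pos_nonneg pos_less_divide_eq)
        ultimately show False by simp
      qed
      have harm: "sphere_harmonic_on (D - {Some a'}) v"
        unfolding sphere_harmonic_on_def
      proof (intro conjI impI)
        show "openin sphere_topology (D - {Some a'})"
        proof (rule openin_diff[OF D])
          show "closedin sphere_topology {Some a'}"
            using closedin_Alexandroff_compactification_image_Some[of euclidean "{a'}"] by simp
        qed
        \<comment> \<open>\<open>?S\<close> misses \<open>a\<close>, where the formula with
          \<open>gr\<close> breaks down; \<open>?T\<close> restores it through the formula with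
          \<open>h\<close>.\<close>
        let ?S = "{z. Some z \<in> D - {Some a}} \<inter> - {a'}" and ?T = "ball a \<delta> - {a'}"
        have gS: "harmonic_on {z. Some z \<in> D - {Some a}} (\<lambda>z. gr (Some z))"
          using gharm by (simp add: sphere_harmonic_on_def)
        have "open ?S"
          using harmonic_on_open[OF gS] by (intro open_Int) auto
        have log: "harmonic_on (- {b}) (\<lambda>z. s * ln (cmod (z - b)))" for b s
        proof -
          have "{z. 1 * z + - b \<noteq> 0} = - {b}"
            by auto
          then show ?thesis
            using harmonic_on_ln_affine[of 1 "- b" s] by simp
        qed
        have "harmonic_on ?S (\<lambda>z. gr (Some z) + (1 * ln (cmod (z - a)) + (- 1 * ln (cmod (z - a')) + \<epsilon>)))"
          by (intro harmonic_on_add harmonic_on_const harmonic_on_subset[OF gS]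
              harmonic_on_subset[OF log] \<open>open ?S\<close>) auto
        then have S: "harmonic_on ?S (\<lambda>z. v (Some z))"
          by (rule harmonic_on_cong) (auto simp: v_far)
        have "open ?T"
          by (intro open_Diff) auto
        have "harmonic_on ?T (\<lambda>z. h z + (- 1 * ln (cmod (z - a')) + \<epsilon>))"
          using \<delta>(2)
          by (intro harmonic_on_add harmonic_on_const harmonic_on_subset[OF e0(2)]
              harmonic_on_subset[OF log] \<open>open ?T\<close>) auto
        then have T: "harmonic_on ?T (\<lambda>z. v (Some z))"
          by (rule harmonic_on_cong) (auto simp: v_near)
        have "{z. Some z \<in> D - {Some a'}} = ?S \<union> ?T"
          using \<delta>(1,3) False by auto
        then show "harmonic_on {z. Some z \<in> D - {Some a'}} (\<lambda>z. v (Some z))"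
          using harmonic_on_Un[OF S T] by simp
        assume "None \<in> D - {Some a'}"
        then obtain e where e: "e > 0" "harmonic_on (ball 0 e) (\<lambda>z. gr (chart_infinity z))"
          using gharm by (auto simp: sphere_harmonic_on_def)
        define e' where "e' = min e (1 / (1 + cmod a + cmod a'))"
        have log': "harmonic_on (ball 0 e') (\<lambda>w. s * ln (cmod (- b * w + 1)))"
          if b: "cmod b \<le> cmod a + cmod a'" for b s
        proof (rule harmonic_on_subset[OF harmonic_on_ln_affine])
          show "ball 0 e' \<subseteq> {w. - b * w + 1 \<noteq> 0}"
          proof
            fix w :: complex assume "w \<in> ball 0 e'"
            then have "w * b \<noteq> 1"
              using b by (intro nz) (auto simp: e'_def)
            then show "w \<in> {w. - b * w + 1 \<noteq> 0}"
              by (simp add: add_eq_0_iff mult.commute)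
          qed
        qed simp
        \<comment> \<open>With z = 1/w the terms - log |w| of log |z - a| and log |z - a'| cancel,
          leaving log |1 - a w| - log |1 - a' w|, which is harmonic across w = 0.\<close>
        have "harmonic_on (ball 0 e') (\<lambda>w. gr (chart_infinity w) +
            (1 * ln (cmod (- a * w + 1)) + (- 1 * ln (cmod (- a' * w + 1)) + \<epsilon>)))"
          by (intro harmonic_on_add harmonic_on_const harmonic_on_subset[OF e(2)] log')
            (auto simp: e'_def)
        then have "harmonic_on (ball 0 e') (\<lambda>w. v (chart_infinity w))"
        proof (rule harmonic_on_cong)
          fix w :: complex assume w: "w \<in> ball 0 e'"
          show "gr (chart_infinity w) + (1 * ln (cmod (- a * w + 1)) + (- 1 * ln (cmod (- a' * w + 1)) + \<epsilon>))
              = v (chart_infinity w)"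
          proof (cases "w = 0")
            case True
            then show ?thesis
              by (simp add: chart_infinity_def v_def)
          next
            case w0: False
            have *: "ln (cmod (inverse w - b)) = ln (cmod (- b * w + 1)) - ln (cmod w)" "inverse w \<noteq> b"
              if b: "cmod b \<le> cmod a + cmod a'" for b
            proof -
              have wb: "w * b \<noteq> 1"
                using w b by (intro nz) (auto simp: e'_def)
              then show "inverse w \<noteq> b"
                using w0 by auto
              have "inverse w - b = (- b * w + 1) / w"
                using w0 by (simp add: field_simps)
              moreover have "- b * w + 1 \<noteq> 0"
                using wb by (simp add: add_eq_0_iff mult.commute)
              ultimately show "ln (cmod (inverse w - b)) = ln (cmod (- b * w + 1)) - ln (cmod w)"
                using w0 by (simp add: norm_divide ln_div)
            qed
            show ?thesis
              using w0 *[of a] *[of a'] by (simp add: chart_infinity_def v_def)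
          qed
        qed
        moreover have "e' > 0"
          using e(1) by (simp add: e'_def add_pos_nonneg)
        ultimately show "\<exists>e>0. harmonic_on (ball 0 e) (\<lambda>z. v (chart_infinity z))"
          by blast
      qed
      have "positive_harmonic_with_pole D (Some a') U"
        unfolding positive_harmonic_with_pole_def
      proof (intro conjI)
        show "U (Some a') = \<infinity>"
          by (simp add: U_def)
        show "\<forall>z\<in>D - {Some a'}. 0 \<le> U z \<and> U z < \<infinity>"
          using v_pos by (simp add: U_def)
        have 1: "harmonic_on {z. Some z \<in> D - {Some a'}} (\<lambda>z. real_of_ereal (U (Some z)))"
        proof (rule harmonic_on_cong)
          show "harmonic_on {z. Some z \<in> D - {Some a'}} (\<lambda>z. v (Some z))"
            using harm unfolding sphere_harmonic_on_def by blast
        qed (simp add: U_def)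
        have 2: "\<exists>e>0. harmonic_on (ball 0 e) (\<lambda>z. real_of_ereal (U (chart_infinity z)))"
          if N: "None \<in> D - {Some a'}"
        proof -
          obtain e where e: "e > 0" "harmonic_on (ball 0 e) (\<lambda>z. v (chart_infinity z))"
            using harm N by (auto simp: sphere_harmonic_on_def)
          \<comment> \<open>Shrinking the disc avoids the new pole, so that \<open>U\<close> is
            given by the finite function \<open>v\<close> throughout the chart.\<close>
          define e' where "e' = min e (1 / (1 + cmod a + cmod a'))"
          have "harmonic_on (ball 0 e') (\<lambda>z. v (chart_infinity z))"
            by (rule harmonic_on_subset[OF e(2)]) (auto simp: e'_def)
          then have "harmonic_on (ball 0 e') (\<lambda>z. real_of_ereal (U (chart_infinity z)))"
          proof (rule harmonic_on_cong)
            fix w :: complex assume "w \<in> ball 0 e'"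
            then have "w * a' \<noteq> 1"
              by (intro nz) (auto simp: e'_def)
            then show "v (chart_infinity w) = real_of_ereal (U (chart_infinity w))"
              by (auto simp: U_def chart_infinity_def)
          qed
          moreover have "e' > 0"
            using e(1) by (simp add: e'_def add_pos_nonneg)
          ultimately show ?thesis
            by blast
        qed
        show "sphere_harmonic_on (D - {Some a'}) (\<lambda>z. real_of_ereal (U z))"
          using 1 2 harm by (simp add: sphere_harmonic_on_def)
        \<comment> \<open>Near \<open>a'\<close> the formula \<open>v_near\<close> applies, so the
          regular part of \<open>U\<close> at its pole is \<open>h + \<epsilon>\<close>.\<close>
        obtain e where e: "e > 0" "ball a' e \<subseteq> ball a \<delta>"
          using a' by (meson open_ball open_contains_ball)
        show "log_pole_at (Some a') (\<lambda>z. real_of_ereal (U z))"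
          unfolding log_pole_at_def option.case
        proof (intro exI conjI ballI)
          show "e > 0" by fact
          show "harmonic_on (ball a' e) (\<lambda>z. h z + \<epsilon>)"
            using e \<delta>(2) by (intro harmonic_on_add harmonic_on_const harmonic_on_subset[OF e0(2)]) auto
          show "real_of_ereal (U (Some z)) = h z + \<epsilon> - ln (cmod (z - a'))" if "z \<in> ball a' e - {a'}" for z
            using v_near[of z] e that by (auto simp: U_def)
        qed
      qed
      moreover have "Some a' \<in> D"
        using a' \<delta>(3) by auto
      ultimately have "g (Some z) (Some a') \<le> U (Some z)"
        using g z(1) by (simp add: green_function_def)
      also have "U (Some z) = ereal (v (Some z))"
        using z by (simp add: U_def)
      finally show ?thesis
        using v_far[OF z(2)] by (simp add: gr_def \<epsilon>_def)
    qed
  qed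
qed

lemma green_function_nonneg:
  assumes "green_function D g" "Some a \<in> D" "Some z \<in> D"
  shows "0 \<le> g (Some z) (Some a)"
proof -
  have "positive_harmonic_with_pole D (Some a) (\<lambda>s. g s (Some a))"
    using assms by (simp add: green_function_def)
  then show ?thesis
    using assms(3) by (cases "z = a") (simp_all add: positive_harmonic_with_pole_def)
qed

text \<open>Near an off-diagonal point (w, a) the preceding lemma bounds \<open>g\<close> by a
  continuous function \<open>\<Phi>\<close> whose value at (w, a) is g(w, a): the two logarithms
  cancel there and the last term vanishes. Diagonal points carry the value infinity and lie in no
  set g < c.\<close>

lemma green_function_usc:
  assumes D: "openin sphere_topology D" and g: "green_function D g" and K: "Some ` K \<subseteq> D"
  shows "openin (top_of_set (K \<times> K)) {x \<in> K \<times> K. g (Some (fst x)) (Some (snd x)) < c}"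
    (is "openin _ ?E")
  unfolding openin_subopen[of _ ?E]
proof
  fix x assume x: "x \<in> ?E"
  obtain w a where wa: "x = (w, a)"
    by fastforce
  have mem: "w \<in> K" "a \<in> K" "Some w \<in> D" "Some a \<in> D" and less: "g (Some w) (Some a) < c"
    using x K by (auto simp: wa)
  have pos: "positive_harmonic_with_pole D (Some a) (\<lambda>s. g s (Some a))"
    using g mem by (simp add: green_function_def)
  have "w \<noteq> a"
    using less pos by (auto simp: positive_harmonic_with_pole_def)
  define gr where "gr = (\<lambda>z. real_of_ereal (g (Some z) (Some a)))"
  have gw: "g (Some w) (Some a) = ereal (gr w)"
    using pos mem \<open>w \<noteq> a\<close> by (simp add: positive_harmonic_with_pole_def gr_def ereal_real' less_top)
  have "harmonic_on {z. Some z \<in> D - {Some a}} gr"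
    using pos by (simp add: positive_harmonic_with_pole_def sphere_harmonic_on_def gr_def)
  then have "isCont gr w"
    using harmonic_on_imp_continuous_on harmonic_on_open mem \<open>w \<noteq> a\<close>
    by (fastforce simp: continuous_on_eq_continuous_at)
  obtain \<delta> where \<delta>: "\<delta> > 0"
    "\<And>a' z. a' \<in> ball a \<delta> \<Longrightarrow> Some z \<in> D \<Longrightarrow> z \<noteq> a \<Longrightarrow> z \<noteq> a' \<Longrightarrow>
      g (Some z) (Some a') \<le> ereal (gr z + ln (cmod (z - a)) - ln (cmod (z - a')) + cmod (a - a') / \<delta>)"
    using green_function_shift_pole[OF D g mem(4)] unfolding gr_def by blast
  define \<Phi> where "\<Phi> y = gr (fst y) + ln (cmod (fst y - a)) - ln (cmod (fst y - snd y))
      + cmod (a - snd y) / \<delta>" for y :: "complex \<times> complex"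
  have f: "(fst \<longlongrightarrow> w) (nhds x)" and s: "(snd \<longlongrightarrow> a) (nhds x)"
    using tendsto_fst[OF filterlim_ident[of "nhds x"]] tendsto_snd[OF filterlim_ident[of "nhds x"]]
    by (simp_all add: wa)
  have "(\<Phi> \<longlongrightarrow> gr w + ln (cmod (w - a)) - ln (cmod (w - a)) + cmod (a - a) / \<delta>) (nhds x)"
    unfolding \<Phi>_def using \<open>w \<noteq> a\<close> \<delta>(1)
    by (intro tendsto_intros f s isCont_tendsto_compose[OF \<open>isCont gr w\<close>]) auto
  then have "((\<lambda>y. ereal (\<Phi> y)) \<longlongrightarrow> ereal (gr w)) (nhds x)"
    by simp
  then have "\<forall>\<^sub>F y in nhds x. ereal (\<Phi> y) < c"
    using less gw by (simp add: order_tendsto_iff)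
  moreover have "\<forall>\<^sub>F y in nhds x. fst y \<noteq> a"
    using tendsto_imp_eventually_ne[OF f \<open>w \<noteq> a\<close>] .
  moreover have "\<forall>\<^sub>F y in nhds x. fst y - snd y \<noteq> 0"
    using \<open>w \<noteq> a\<close> by (intro tendsto_imp_eventually_ne[OF tendsto_diff[OF f s]]) simp
  moreover have "\<forall>\<^sub>F y in nhds x. dist (snd y) a < \<delta>"
    using tendstoD[OF s \<delta>(1)] .
  ultimately have "\<forall>\<^sub>F y in nhds x. y \<in> K \<times> K \<longrightarrow> y \<in> ?E"
  proof eventually_elim
    case (elim y)
    show ?case
    proof
      assume y: "y \<in> K \<times> K"
      have "g (Some (fst y)) (Some (snd y)) \<le> ereal (\<Phi> y)"
        unfolding \<Phi>_def using elim y K by (intro \<delta>(2)) (auto simp: dist_commute)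
      then show "y \<in> ?E"
        using elim(1) y by (auto elim: le_less_trans)
    qed
  qed
  then obtain S where S: "open S" "x \<in> S" "\<And>y. y \<in> S \<Longrightarrow> y \<in> K \<times> K \<longrightarrow> y \<in> ?E"
    unfolding eventually_nhds by blast
  show "\<exists>T. openin (top_of_set (K \<times> K)) T \<and> x \<in> T \<and> T \<subseteq> ?E"
  proof (intro exI conjI)
    show "openin (top_of_set (K \<times> K)) (K \<times> K \<inter> S)"
      using S(1) by (rule openin_open_Int)
  qed (use S x in auto)
qed

subsection \<open>The constrained energy problem\<close>

text \<open>Potential theory enters only through these properties: a measurable nonnegative kernel
  and a measurable field bounded below. Convergence of minimizers is proved at this
  generality.\<close>

locale constrained_energy_problem =
  fixes K :: "complex set" and g :: "sphere \<Rightarrow> sphere \<Rightarrow> ereal" and f :: "complex \<Rightarrow> ereal"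
    and c :: real and lam :: "complex measure"
  assumes kernel_measurable: "(\<lambda>x. e2ennreal (g (Some (fst x)) (Some (snd x)))) \<in>
      borel_measurable (restrict_space borel K \<Otimes>\<^sub>M restrict_space borel K)"
    and kernel_nonneg: "\<And>z \<zeta>. z \<in> K \<Longrightarrow> \<zeta> \<in> K \<Longrightarrow> 0 \<le> g (Some z) (Some \<zeta>)"
    and field_measurable: "f \<in> borel_measurable (restrict_space borel K)"
    and c_nonneg: "0 \<le> c" and field_bounded_below: "\<And>z. z \<in> K \<Longrightarrow> - ereal c \<le> f z"
    and lam: "borel_measure_on K lam"
begin

lemma borel_measure_onD:
  assumes "borel_measure_on K \<mu>"
  shows "sets \<mu> = sets lam" "space \<mu> = K" "finite_measure \<mu>"
    "sets \<mu> = sets (restrict_space borel K)"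
proof -
  show *: "sets \<mu> = sets (restrict_space borel K)" "finite_measure \<mu>"
    using assms by (simp_all add: borel_measure_on_def)
  show "sets \<mu> = sets lam"
    using *(1) lam by (simp add: borel_measure_on_def)
  show "space \<mu> = K"
    using sets_eq_imp_space_eq[OF *(1)] by (simp add: space_restrict_space)
qed

text \<open>This is J + 2 c \<mu>(K), with the iterated integral replaced by one over the product
  measure. Both integrands are nonnegative, so monotonicity and the Fatou inequality apply
  directly.\<close>

definition shifted_energy :: "complex measure \<Rightarrow> ereal" where
  "shifted_energy \<mu> =
     enn2ereal (\<integral>\<^sup>+x. e2ennreal (g (Some (fst x)) (Some (snd x))) \<partial>(\<mu> \<Otimes>\<^sub>M \<mu>)) +
     2 * enn2ereal (\<integral>\<^sup>+x. e2ennreal (f x + ereal c) \<partial>\<mu>)"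

lemma kernel_measurable':
  assumes "borel_measure_on K \<mu>"
  shows "(\<lambda>x. e2ennreal (g (Some (fst x)) (Some (snd x)))) \<in> borel_measurable (\<mu> \<Otimes>\<^sub>M \<mu>)"
proof -
  note * = borel_measure_onD(4)[OF assms]
  show ?thesis
    using kernel_measurable by (subst measurable_cong_sets[OF sets_pair_measure_cong[OF * *] refl])
qed

lemma field_measurable':
  assumes "borel_measure_on K \<mu>"
  shows "f \<in> borel_measurable \<mu>"
  using field_measurable by (subst measurable_cong_sets[OF borel_measure_onD(4)[OF assms] refl])

text \<open>Tonelli's theorem for the kernel term and \<open>ereal_integral_add_const\<close> for
  the field. The subtracted mass term is real, so the rearrangements hold for infinite energies as
  well.\<close>

lemma weighted_energy_eq_shifted_energy:
  assumes \<mu>: "borel_measure_on K \<mu>"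
  shows "weighted_energy g f \<mu> = shifted_energy \<mu> - ereal (2 * c * measure \<mu> K)"
proof -
  let ?k = "\<lambda>z \<zeta>. g (Some z) (Some \<zeta>)"
  note sp = borel_measure_onD(2)[OF \<mu>]
  interpret finite_measure \<mu>
    by (rule borel_measure_onD(3)[OF \<mu>])
  interpret pair_sigma_finite \<mu> \<mu> ..
  have inner: "ereal_integral \<mu> (\<lambda>z. ?k z \<zeta>) = enn2ereal (\<integral>\<^sup>+z. e2ennreal (?k z \<zeta>) \<partial>\<mu>)" if "\<zeta> \<in> K" for \<zeta>
    using kernel_nonneg that by (intro ereal_integral_nonneg) (simp add: sp)
  have "energy ?k \<mu> = enn2ereal (\<integral>\<^sup>+\<zeta>. e2ennreal (ereal_integral \<mu> (\<lambda>z. ?k z \<zeta>)) \<partial>\<mu>)"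
    unfolding energy_def by (intro ereal_integral_nonneg) (simp add: sp inner)
  also have "(\<integral>\<^sup>+\<zeta>. e2ennreal (ereal_integral \<mu> (\<lambda>z. ?k z \<zeta>)) \<partial>\<mu>) = (\<integral>\<^sup>+\<zeta>. (\<integral>\<^sup>+z. e2ennreal (?k z \<zeta>) \<partial>\<mu>) \<partial>\<mu>)"
    by (intro nn_integral_cong) (simp add: sp inner)
  also have "\<dots> = (\<integral>\<^sup>+x. e2ennreal (?k (fst x) (snd x)) \<partial>(\<mu> \<Otimes>\<^sub>M \<mu>))"
    using nn_integral_snd[OF kernel_measurable'[OF \<mu>]] by simp
  finally have E: "energy ?k \<mu> = enn2ereal (\<integral>\<^sup>+x. e2ennreal (?k (fst x) (snd x)) \<partial>(\<mu> \<Otimes>\<^sub>M \<mu>))" .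
  have F: "ereal_integral \<mu> f = enn2ereal (\<integral>\<^sup>+x. e2ennreal (f x + ereal c) \<partial>\<mu>) - ereal (c * measure \<mu> K)"
    using ereal_integral_add_const[OF finite_measure_axioms field_measurable'[OF \<mu>] c_nonneg]
      field_bounded_below by (simp add: sp)
  have "2 * (enn2ereal y - ereal d) = 2 * enn2ereal y - ereal (2 * d)" for y d
    by (cases y) (auto simp: algebra_simps)
  moreover have "enn2ereal x + (2 * enn2ereal y - ereal d) = enn2ereal x + 2 * enn2ereal y - ereal d" for x y d
    by (cases x; cases y) auto
  ultimately show ?thesis
    unfolding weighted_energy_def shifted_energy_def E F by (simp add: mult.assoc)
qed

lemma shifted_energy_mono:
  assumes "borel_measure_on K \<mu>" "borel_measure_on K \<nu>" "\<nu> \<le> \<mu>"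
  shows "shifted_energy \<nu> \<le> shifted_energy \<mu>"
proof -
  have s: "sets \<nu> = sets \<mu>" and fin: "finite_measure \<mu>"
    using borel_measure_onD assms by metis+
  have "(\<integral>\<^sup>+x. u x \<partial>(\<nu> \<Otimes>\<^sub>M \<nu>)) \<le> (\<integral>\<^sup>+x. u x \<partial>(\<mu> \<Otimes>\<^sub>M \<mu>))" for u
    by (intro nn_integral_mono_measure sets_pair_measure_cong pair_measure_mono s assms(3) fin)
  moreover have "(\<integral>\<^sup>+x. u x \<partial>\<nu>) \<le> (\<integral>\<^sup>+x. u x \<partial>\<mu>)" for u
    by (intro nn_integral_mono_measure s assms(3))
  ultimately show ?thesis
    unfolding shifted_energy_def
    by (intro add_mono ereal_mult_left_mono) (simp_all flip: less_eq_ennreal.rep_eq)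
qed

text \<open>The Fatou inequality is applied to the kernel along the product measures and to the
  shifted field along \<open>N\<close> itself; lower limits are superadditive.\<close>

lemma shifted_energy_liminf:
  assumes M: "finite_measure M" "sets M = sets lam"
    and N: "\<And>n. borel_measure_on K (N n)" "\<And>n. N n \<le> M"
    and P: "borel_measure_on K P" "P \<le> M"
    and lim: "\<And>A. A \<in> sets M \<Longrightarrow> (\<lambda>n. emeasure (N n) A) \<longlonglongrightarrow> emeasure P A"
  shows "shifted_energy P \<le> liminf (\<lambda>n. shifted_energy (N n))"
proof -
  have s: "sets (N n) = sets M" "sets P = sets M" for n
    using borel_measure_onD(1) N P M(2) by auto
  let ?k = "\<lambda>x. e2ennreal (g (Some (fst x)) (Some (snd x)))" and ?f = "\<lambda>x. e2ennreal (f x + ereal c)"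
  have sPP: "sets (P \<Otimes>\<^sub>M P) = sets (M \<Otimes>\<^sub>M M)"
    by (intro sets_pair_measure_cong s)
  have "enn2ereal (\<integral>\<^sup>+x. ?k x \<partial>(P \<Otimes>\<^sub>M P)) \<le> liminf (\<lambda>n. enn2ereal (\<integral>\<^sup>+x. ?k x \<partial>(N n \<Otimes>\<^sub>M N n)))"
  proof (rule enn2ereal_nn_integral_liminf_setwise[OF kernel_measurable'[OF P(1)]])
    show "sets (N n \<Otimes>\<^sub>M N n) = sets (P \<Otimes>\<^sub>M P)" for n
      unfolding sPP by (intro sets_pair_measure_cong s)
    show "(\<lambda>n. emeasure (N n \<Otimes>\<^sub>M N n) A) \<longlonglongrightarrow> emeasure (P \<Otimes>\<^sub>M P) A"
      if "A \<in> sets (P \<Otimes>\<^sub>M P)" for A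
      using that lim unfolding sPP
      by (intro pair_measure_setwise[OF M(1) s(1) N(2) s(2) P(2)]) simp_all
  qed
  moreover have "2 * enn2ereal (\<integral>\<^sup>+x. ?f x \<partial>P) \<le> liminf (\<lambda>n. 2 * enn2ereal (\<integral>\<^sup>+x. ?f x \<partial>N n))"
  proof -
    have "?f \<in> borel_measurable P"
      using field_measurable'[OF P(1)] by measurable
    then have "enn2ereal (\<integral>\<^sup>+x. ?f x \<partial>P) \<le> liminf (\<lambda>n. enn2ereal (\<integral>\<^sup>+x. ?f x \<partial>N n))"
      by (rule enn2ereal_nn_integral_liminf_setwise) (simp_all add: s lim)
    then have "2 * enn2ereal (\<integral>\<^sup>+x. ?f x \<partial>P) \<le> 2 * liminf (\<lambda>n. enn2ereal (\<integral>\<^sup>+x. ?f x \<partial>N n))"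
      by (rule ereal_mult_left_mono) simp
    also have "\<dots> = liminf (\<lambda>n. 2 * enn2ereal (\<integral>\<^sup>+x. ?f x \<partial>N n))"
      using Liminf_ereal_mult_left[of sequentially 2 "\<lambda>n. enn2ereal (\<integral>\<^sup>+x. ?f x \<partial>N n)"] by simp
    finally show ?thesis .
  qed
  ultimately have "shifted_energy P \<le> liminf (\<lambda>n. enn2ereal (\<integral>\<^sup>+x. ?k x \<partial>(N n \<Otimes>\<^sub>M N n)))
      + liminf (\<lambda>n. 2 * enn2ereal (\<integral>\<^sup>+x. ?f x \<partial>N n))"
    unfolding shifted_energy_def by (rule add_mono)
  also have "\<dots> \<le> liminf (\<lambda>n. shifted_energy (N n))"
    unfolding shifted_energy_def by (intro Liminf_add_le) auto
  finally show ?thesis .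
qed

section \<open>Admissible measures and convergence of minimizers\<close>

lemma constrained_measuresD:
  assumes "\<mu> \<in> constrained_measures K lam R"
  shows "borel_measure_on K \<mu>" "\<And>A. A \<in> sets lam \<Longrightarrow> emeasure \<mu> A \<le> ennreal R * emeasure lam A"
proof -
  show \<mu>: "borel_measure_on K \<mu>"
    using assms by (simp add: constrained_measures_def)
  have "sets \<mu> = sets (scale_measure (ennreal R) lam)"
    using borel_measure_onD(1)[OF \<mu>] by simp
  from le_measure[OF this] show "emeasure \<mu> A \<le> ennreal R * emeasure lam A" if "A \<in> sets lam" for A
    using assms that borel_measure_onD(1)[OF \<mu>] by (simp add: constrained_measures_def)
qed

lemma constrained_measuresI:
  assumes "sets \<mu> = sets lam" "finite_measure \<mu>"
    "\<And>A. A \<in> sets lam \<Longrightarrow> emeasure \<mu> A \<le> ennreal R * emeasure lam A"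
  shows "\<mu> \<in> constrained_measures K lam R"
proof -
  have "\<mu> \<le> scale_measure (ennreal R) lam"
    using assms(3) by (subst le_measure) (simp_all add: assms(1))
  moreover have "borel_measure_on K \<mu>"
    using assms(2) lam unfolding borel_measure_on_def assms(1) by simp
  ultimately show ?thesis
    by (simp add: constrained_measures_def)
qed

lemma min_energy_le:
  "\<mu> \<in> constrained_measures K lam R \<Longrightarrow> min_energy g f K lam R \<le> weighted_energy g f \<mu>"
  unfolding min_energy_def by (rule INF_lower)

text \<open>Rescaling a competitor for \<open>R\<close> by \<open>min 1 (R' / R)\<close> gives a competitor for \<open>R'\<close>.  If \<open>R = 0\<close>
  the factor is \<open>0\<close>, which is harmless because then \<open>\<mu> = 0\<close>.\<close>

lemma min_energy_le_rescaled:
  assumes \<mu>: "\<mu> \<in> constrained_measures K lam R" and R: "0 \<le> R" "0 < R'"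
  shows "min_energy g f K lam R'
    \<le> shifted_energy \<mu> - ereal (2 * c * (min 1 (R' / R) * measure \<mu> K))"
proof -
  define t where "t = min 1 (R' / R)"
  have t: "0 \<le> t" "t \<le> 1" "t * R \<le> R'"
    using R by (auto simp: t_def min_def field_simps)
  note \<mu>' = constrained_measuresD[OF \<mu>]
  note \<mu>s = borel_measure_onD[OF \<mu>'(1)]
  define \<nu> where "\<nu> = scale_measure (ennreal t) \<mu>"
  have \<nu>s: "sets \<nu> = sets lam"
    using \<mu>s by (simp add: \<nu>_def)
  have le: "emeasure \<nu> A \<le> emeasure \<mu> A" for A
    using mult_right_mono[of "ennreal t" 1 "emeasure \<mu> A"] t by (simp add: \<nu>_def)
  then have "\<nu> \<le> \<mu>"
    by (subst le_measure) (auto simp: \<nu>s \<mu>s)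
  have \<nu>: "\<nu> \<in> constrained_measures K lam R'"
  proof (rule constrained_measuresI[OF \<nu>s])
    show "finite_measure \<nu>"
      using \<mu>s \<nu>s \<open>\<nu> \<le> \<mu>\<close> by (intro finite_measure_mono_measure[OF \<mu>s(3)]) auto
    fix A assume A: "A \<in> sets lam"
    have "emeasure \<nu> A \<le> ennreal t * (ennreal R * emeasure lam A)"
      unfolding \<nu>_def using \<mu>'(2)[OF A] by (simp add: mult_left_mono)
    also have "\<dots> = ennreal (t * R) * emeasure lam A"
      using t R by (simp add: ennreal_mult mult.assoc)
    also have "\<dots> \<le> ennreal R' * emeasure lam A"
      using t by (intro mult_right_mono) (auto simp: ennreal_leI)
    finally show "emeasure \<nu> A \<le> ennreal R' * emeasure lam A" .
  qed
  note \<nu>' = constrained_measuresD(1)[OF \<nu>]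
  have "min_energy g f K lam R' \<le> weighted_energy g f \<nu>"
    by (rule min_energy_le[OF \<nu>])
  also have "\<dots> = shifted_energy \<nu> - ereal (2 * c * (t * measure \<mu> K))"
    unfolding weighted_energy_eq_shifted_energy[OF \<nu>'] using t by (simp add: \<nu>_def)
  \<comment> \<open>The factor \<open>t\<close> is dropped from the energy by monotonicity but kept
    in the mass term, which enters with a minus sign; as \<open>t\<close> tends to 1 nothing is
    lost.\<close>
  also have "\<dots> \<le> shifted_energy \<mu> - ereal (2 * c * (t * measure \<mu> K))"
    by (intro ereal_minus_mono shifted_energy_mono \<nu>' \<mu>'(1) \<open>\<nu> \<le> \<mu>\<close>) simp
  finally show ?thesis
    by (simp add: t_def)
qed

text \<open>For the setwise limit \<open>P\<close> of a subsequence, J(P) \<le> liminf v \<le>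
  limsup v \<le> v(R) \<le> J(P): by semicontinuity, trivially, by rescaling, and by admissibility
  of \<open>P\<close>. Equality gives convergence of the values, and uniqueness gives
  \<open>P = \<mu>0\<close>.\<close>

lemma minimizers_subseq_converge:
  assumes R: "\<And>n. 0 < R_seq n" "R_seq \<longlonglongrightarrow> R"
    and min: "\<And>n. constrained_minimizer g f K lam (R_seq n) (\<mu> n)"
    and uniq: "unique_constrained_minimizer g f K lam R \<mu>0"
  obtains s where "strict_mono (s :: nat \<Rightarrow> nat)"
    "\<And>A. A \<in> sets lam \<Longrightarrow> (\<lambda>n. emeasure (\<mu> (s n)) A) \<longlonglongrightarrow> emeasure \<mu>0 A"
    "(\<lambda>n. min_energy g f K lam (R_seq (s n))) \<longlonglongrightarrow> min_energy g f K lam R"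
proof -
  have min0: "\<mu>0 \<in> constrained_measures K lam R" "weighted_energy g f \<mu>0 = min_energy g f K lam R"
    using uniq by (auto simp: unique_constrained_minimizer_def constrained_minimizer_def)
  have min': "\<mu> n \<in> constrained_measures K lam (R_seq n)"
    "weighted_energy g f (\<mu> n) = min_energy g f K lam (R_seq n)" for n
    using min by (auto simp: constrained_minimizer_def)
  note \<mu> = constrained_measuresD[OF min'(1)] and \<mu>0 = constrained_measuresD[OF min0(1)]
  have R0: "0 \<le> R"
    using R by (intro LIMSEQ_le_const[OF R(2)]) (auto intro: less_imp_le)
  \<comment> \<open>A convergent sequence is bounded, so all minimizers lie below the single finite
    measure \<open>M\<close>.\<close>
  obtain B where B: "\<And>n. R_seq n \<le> B"
    using convergent_imp_Bseq[OF convergentI[OF R(2)]] by (auto simp: Bseq_def abs_le_iff)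
  define M where "M = scale_measure (ennreal B) lam"
  have sM: "sets M = sets lam"
    by (simp add: M_def)
  have flam: "finite_measure lam"
    using lam by (simp add: borel_measure_on_def)
  interpret lam: finite_measure lam by fact
  interpret M: finite_measure M
  proof (rule finite_measureI)
    have "emeasure M (space M) = ennreal B * ennreal (measure lam (space lam))"
      by (simp add: M_def space_scale_measure lam.emeasure_eq_measure)
    then show "emeasure M (space M) \<noteq> \<infinity>"
      by (simp add: ennreal_mult_eq_top_iff)
  qed
  have s\<mu>: "sets (\<mu> n) = sets M" for n
    using borel_measure_onD(1)[OF \<mu>(1)] by (simp add: sM)
  have leM: "\<mu> n \<le> M" for n
  proof -
    have "emeasure (\<mu> n) A \<le> emeasure M A" if "A \<in> sets lam" for A
    proof -
      have "emeasure (\<mu> n) A \<le> ennreal (R_seq n) * emeasure lam A"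
        by (rule \<mu>(2)[OF that])
      also have "\<dots> \<le> ennreal B * emeasure lam A"
        using B by (intro mult_right_mono) (auto simp: ennreal_leI)
      finally show ?thesis
        by (simp add: M_def)
    qed
    then show ?thesis
      by (simp add: le_measure s\<mu> sM)
  qed
  have spM: "space M = K"
    using borel_measure_onD(2)[OF lam] by (simp add: M_def space_scale_measure)
  obtain G where G: "countable G" "Int_stable G" "G \<subseteq> Pow K" "K \<in> G"
    "sets (restrict_space borel K) = sigma_sets K G"
    by (rule restrict_borel_countable_Int_stable_generator)
  have GM: "G \<subseteq> Pow (space M)" "sets M = sigma_sets (space M) G" "space M \<in> G"
    using G borel_measure_onD(4)[OF lam] by (simp_all add: spM sM)
  obtain s P where s: "strict_mono (s :: nat \<Rightarrow> nat)" and P: "sets P = sets M" "P \<le> M"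
    and lim: "\<And>A. A \<in> sets M \<Longrightarrow> (\<lambda>n. emeasure (\<mu> (s n)) A) \<longlonglongrightarrow> emeasure P A"
    by (rule setwise_compact[OF M.finite_measure_axioms s\<mu> leM G(2) GM G(1)]) (rule that)
  have Rs: "(\<lambda>n. R_seq (s n)) \<longlonglongrightarrow> R"
    using LIMSEQ_subseq_LIMSEQ[OF R(2) s] by (simp add: comp_def)
  have fP: "finite_measure P"
    by (rule finite_measure_mono_measure[OF M.finite_measure_axioms P])
  have adm: "P \<in> constrained_measures K lam R"
  proof (rule constrained_measuresI[OF _ fP])
    show "sets P = sets lam"
      using P(1) sM by simp
    fix A assume A: "A \<in> sets lam"
    show "emeasure P A \<le> ennreal R * emeasure lam A"
    \<comment> \<open>The constraint passes to the limit set by set, since \<open>lam\<close> is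
      finite.\<close>
    proof (rule LIMSEQ_le[OF lim])
      show "(\<lambda>n. ennreal (R_seq (s n)) * emeasure lam A) \<longlonglongrightarrow> ennreal R * emeasure lam A"
        by (intro tendsto_mult_ennreal tendsto_ennrealI Rs tendsto_const)
          (simp add: lam.emeasure_eq_measure)
    qed (use A \<mu>(2) sM in auto)
  qed
  note P' = constrained_measuresD(1)[OF adm]
  let ?v = "\<lambda>n. min_energy g f K lam (R_seq (s n))"
  define b where "b n = 2 * c * (min 1 (R_seq (s n) / R) * measure \<mu>0 K)" for n
  have "b \<longlonglongrightarrow> 2 * c * measure \<mu>0 K"
  \<comment> \<open>For \<open>R = 0\<close> the quotient in \<open>b\<close> is 0 by convention and
    need not tend to 1, but then \<open>\<mu>0\<close> has no mass.\<close>
  proof (cases "R = 0")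
    case True
    have "emeasure \<mu>0 K \<le> ennreal R * emeasure lam K"
      using \<mu>0(2)[OF sets.top[of lam]] borel_measure_onD(2)[OF lam] by simp
    then have "measure \<mu>0 K = 0"
      using True by (simp add: measure_def)
    then show ?thesis
      by (simp add: b_def[abs_def])
  next
    case False
    then have "(\<lambda>n. R_seq (s n) / R) \<longlonglongrightarrow> 1"
      using tendsto_divide[OF Rs tendsto_const[of R]] by simp
    then have "b \<longlonglongrightarrow> 2 * c * (min 1 1 * measure \<mu>0 K)"
      unfolding b_def by (intro tendsto_intros)
    then show ?thesis by simp
  qed
  \<comment> \<open>The energy may be infinite, but subtracting convergent real numbers remains
    continuous.\<close>
  then have "(\<lambda>n. shifted_energy \<mu>0 - ereal (b n)) \<longlonglongrightarrow> shifted_energy \<mu>0 - ereal (2 * c * measure \<mu>0 K)"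
    by (intro tendsto_diff_ereal_general tendsto_const) auto
  then have "limsup (\<lambda>n. shifted_energy \<mu>0 - ereal (b n)) = min_energy g f K lam R"
    unfolding weighted_energy_eq_shifted_energy[OF \<mu>0(1), symmetric] min0(2)
    by (rule lim_imp_Limsup[OF sequentially_bot])
  moreover have "limsup ?v \<le> limsup (\<lambda>n. shifted_energy \<mu>0 - ereal (b n))"
    unfolding b_def
    by (intro Limsup_mono always_eventually allI min_energy_le_rescaled min0(1) R0 R(1))
  ultimately have upper: "limsup ?v \<le> min_energy g f K lam R"
    by simp
  have lower: "weighted_energy g f P \<le> liminf ?v"
  proof -
    let ?m = "\<lambda>n. - ereal (2 * c * measure (\<mu> (s n)) K)"
    have "(\<lambda>n. measure (\<mu> (s n)) K) \<longlonglongrightarrow> measure P K"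
      unfolding measure_def using lim[OF sets.top] fP
      by (intro tendsto_enn2real) (simp_all add: spM finite_measure.emeasure_eq_measure)
    then have m: "?m \<longlonglongrightarrow> - ereal (2 * c * measure P K)"
      by (simp add: tendsto_mult_left tendsto_minus)
    \<comment> \<open>The convergent real mass term comes first, so that it can be taken out of the
      lower limit.\<close>
    have "weighted_energy g f P = - ereal (2 * c * measure P K) + shifted_energy P"
      using weighted_energy_eq_shifted_energy[OF P'] by (simp add: minus_ereal_def add.commute)
    also have "\<dots> \<le> - ereal (2 * c * measure P K) + liminf (\<lambda>n. shifted_energy (\<mu> (s n)))"
      by (intro add_left_mono shifted_energy_liminf[OF M.finite_measure_axioms sM \<mu>(1) leM P' P(2) lim])
    also have "\<dots> = liminf (\<lambda>n. ?m n + shifted_energy (\<mu> (s n)))"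
      by (rule ereal_liminf_lim_add[OF m, symmetric]) simp
    also have "(\<lambda>n. ?m n + shifted_energy (\<mu> (s n))) = ?v"
      by (rule ext) (simp add: weighted_energy_eq_shifted_energy[OF \<mu>(1)] minus_ereal_def add.commute
          flip: min'(2))
    finally show ?thesis .
  qed
  have ll: "liminf ?v \<le> limsup ?v"
    by (rule Liminf_le_Limsup) simp
  have "weighted_energy g f P = min_energy g f K lam R"
    using lower ll upper min_energy_le[OF adm] by (meson order.antisym order.trans)
  then have "P = \<mu>0"
    using uniq adm by (simp add: unique_constrained_minimizer_def constrained_minimizer_def)
  have "liminf ?v = min_energy g f K lam R" "limsup ?v = min_energy g f K lam R"
    using lower ll upper min_energy_le[OF adm] by (meson order.antisym order.trans)+
  then have "?v \<longlonglongrightarrow> min_energy g f K lam R"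
    by (intro Liminf_eq_Limsup) auto
  with s lim show thesis
    by (intro that) (simp_all add: \<open>P = \<mu>0\<close> sM)
qed

text \<open>Every subsequence has a further one with the same limits, so the full sequences
  converge. Continuous functions on the compact \<open>K\<close> are bounded and measurable, hence
  setwise convergence yields weak-star convergence.\<close>

theorem minimizers_converge:
  assumes K: "compact K"
    and R: "\<And>n. 0 < R_seq n" "R_seq \<longlonglongrightarrow> R"
    and min: "\<And>n. constrained_minimizer g f K lam (R_seq n) (\<mu> n)"
    and uniq: "unique_constrained_minimizer g f K lam R \<mu>0"
  shows "weak_star_converges K \<mu> \<mu>0"
    and "(\<lambda>n. min_energy g f K lam (R_seq n)) \<longlonglongrightarrow> min_energy g f K lam R"
proof -
  have bm: "borel_measure_on K (\<mu> n)" "borel_measure_on K \<mu>0" for n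
    using min uniq by (auto simp: unique_constrained_minimizer_def constrained_minimizer_def
        intro: constrained_measuresD(1))
  have sub: "\<exists>s. strict_mono (s :: nat \<Rightarrow> nat) \<and>
      (\<forall>A\<in>sets lam. (\<lambda>n. emeasure (\<mu> (r (s n))) A) \<longlonglongrightarrow> emeasure \<mu>0 A) \<and>
      (\<lambda>n. min_energy g f K lam (R_seq (r (s n)))) \<longlonglongrightarrow> min_energy g f K lam R"
    if "strict_mono r" for r :: "nat \<Rightarrow> nat"
  proof -
    have "(\<lambda>n. R_seq (r n)) \<longlonglongrightarrow> R"
      using LIMSEQ_subseq_LIMSEQ[OF R(2) that] by (simp add: comp_def)
    show ?thesis
      by (rule minimizers_subseq_converge[of "\<lambda>n. R_seq (r n)" R "\<lambda>n. \<mu> (r n)" \<mu>0,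
            OF R(1) \<open>(\<lambda>n. R_seq (r n)) \<longlonglongrightarrow> R\<close> min uniq]) blast
  qed
  show "(\<lambda>n. min_energy g f K lam (R_seq n)) \<longlonglongrightarrow> min_energy g f K lam R"
  proof (rule tendsto_if_subseq_tendsto)
    fix r :: "nat \<Rightarrow> nat" assume "strict_mono r"
    from sub[OF this] show "\<exists>s. strict_mono s \<and>
        (\<lambda>n. min_energy g f K lam (R_seq (r (s n)))) \<longlonglongrightarrow> min_energy g f K lam R"
      by blast
  qed
  show "weak_star_converges K \<mu> \<mu>0"
    unfolding weak_star_converges_def
  proof (intro allI impI)
    fix \<phi> :: "complex \<Rightarrow> real" assume \<phi>: "continuous_on K \<phi>"
    have "bounded (\<phi> ` K)"
      by (intro compact_imp_bounded compact_continuous_image \<phi> K)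
    then obtain b where b: "\<And>z. z \<in> K \<Longrightarrow> \<bar>\<phi> z\<bar> \<le> b"
      by (auto simp: bounded_iff)
    have meas: "\<phi> \<in> borel_measurable \<mu>0"
      using borel_measurable_continuous_on_restrict[OF \<phi>]
        measurable_cong_sets[OF borel_measure_onD(4)[OF bm(2)] refl] by blast
    show "(\<lambda>n. integral\<^sup>L (\<mu> n) \<phi>) \<longlonglongrightarrow> integral\<^sup>L \<mu>0 \<phi>"
    proof (rule tendsto_if_subseq_tendsto)
      fix r :: "nat \<Rightarrow> nat" assume "strict_mono r"
      then obtain s where s: "strict_mono (s :: nat \<Rightarrow> nat)"
        "\<And>A. A \<in> sets lam \<Longrightarrow> (\<lambda>n. emeasure (\<mu> (r (s n))) A) \<longlonglongrightarrow> emeasure \<mu>0 A"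
        using sub by blast
      have "(\<lambda>n. integral\<^sup>L (\<mu> (r (s n))) \<phi>) \<longlonglongrightarrow> integral\<^sup>L \<mu>0 \<phi>"
        by (rule integral_tendsto_setwise[OF meas, where b = b])
          (simp_all add: b s(2) borel_measure_onD[OF bm(1)] borel_measure_onD[OF bm(2)])
      with s(1) show "\<exists>s. strict_mono s \<and> (\<lambda>n. integral\<^sup>L (\<mu> (r (s n))) \<phi>) \<longlonglongrightarrow> integral\<^sup>L \<mu>0 \<phi>"
        by blast
    qed
  qed
qed

end

section \<open>Semicontinuous fields, Green kernels and the final theorem\<close>

text \<open>The relatively open sets f > -n cover \<open>K\<close>, since f is never minus infinity;
  a finite subcover bounds f below.\<close>

lemma lsc_on_compact_bounded_below:
  assumes K: "compact K" and f: "lsc_on K f" "\<And>z. z \<in> K \<Longrightarrow> f z \<noteq> -\<infinity>"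
  obtains c :: real where "0 \<le> c" "\<And>z. z \<in> K \<Longrightarrow> - ereal c \<le> f z"
proof -
  let ?U = "\<lambda>n :: nat. {z \<in> K. ereal (- real n) < f z}"
  have "K \<subseteq> (\<Union>n. ?U n)"
  proof
    fix z assume z: "z \<in> K"
    have "\<exists>n :: nat. ereal (- real n) < f z"
    proof (cases "f z")
      case (real r)
      then show ?thesis
        using reals_Archimedean2[of "- r"] by (auto simp: minus_less_iff)
    qed (use f(2)[OF z] in auto)
    with z show "z \<in> (\<Union>n. ?U n)"
      by blast
  qed
  moreover have "\<forall>C \<in> range ?U. openin (top_of_set K) C"
    using f(1) by (auto simp: lsc_on_def)
  ultimately obtain \<D> where \<D>: "\<D> \<subseteq> range ?U" "finite \<D>" "K \<subseteq> \<Union>\<D>"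
    using K unfolding compact_eq_openin_cover by meson
  obtain I where "finite I" "\<D> = ?U ` I"
    using finite_subset_image[OF \<D>(2,1)] by blast
  then have I: "finite I" "K \<subseteq> (\<Union>n\<in>I. ?U n)"
    using \<D>(3) by simp_all
  show thesis
  \<comment> \<open>Inserting 0 keeps the maximum meaningful when the subcover is empty.\<close>
  proof (rule that[of "real (Max (insert 0 I))"])
    fix z assume "z \<in> K"
    then obtain n where n: "n \<in> I" "ereal (- real n) < f z"
      using I(2) by auto
    have "n \<le> Max (insert 0 I)"
      using I(1) n(1) by simp
    then have "- ereal (real (Max (insert 0 I))) \<le> ereal (- real n)"
      by simp
    also have "\<dots> \<le> f z"
      using n(2) by (rule less_imp_le)
    finally show "- ereal (real (Max (insert 0 I))) \<le> f z" .
  qed simp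
qed

lemma lsc_on_borel_measurable:
  assumes "lsc_on K f"
  shows "f \<in> borel_measurable (restrict_space borel K)"
proof (rule borel_measurableI_greater)
  fix y
  obtain T where "open T" "{z \<in> K. y < f z} = K \<inter> T"
    using assms by (auto simp: lsc_on_def openin_open)
  then show "{z \<in> space (restrict_space borel K). y < f z} \<in> sets (restrict_space borel K)"
    by (auto simp: space_restrict_space sets_restrict_space)
qed

text \<open>Sets g < y are relatively open in K \<times> K by semicontinuity. They are measurable
  for the product sigma-algebra because the inclusion of K \<times> K is measurable into the product
  of two Borel sigma-algebras, which is Borel by second countability.\<close>

lemma green_function_measurable:
  assumes "openin sphere_topology D" "green_function D g" "Some ` K \<subseteq> D"
  shows "(\<lambda>x. g (Some (fst x)) (Some (snd x))) \<in>
    borel_measurable (restrict_space borel K \<Otimes>\<^sub>M restrict_space borel K)" (is "_ \<in> borel_measurable ?M")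
proof (rule borel_measurableI_less)
  fix y
  obtain T where T: "open T" "{x \<in> K \<times> K. g (Some (fst x)) (Some (snd x)) < y} = (K \<times> K) \<inter> T"
    using green_function_usc[OF assms, of y] by (auto simp: openin_open)
  have "(\<lambda>z. z) \<in> restrict_space borel K \<rightarrow>\<^sub>M borel"
    by (rule measurable_restrict_space1) simp
  then have "(\<lambda>x. (fst x, snd x)) \<in> ?M \<rightarrow>\<^sub>M borel \<Otimes>\<^sub>M borel"
    by (intro measurable_Pair measurable_compose[OF measurable_fst] measurable_compose[OF measurable_snd])
  then have "(\<lambda>x. x) \<in> ?M \<rightarrow>\<^sub>M borel"
    by (simp add: borel_prod)
  from measurable_sets[OF this, of T] T(1) have "T \<inter> space ?M \<in> sets ?M"
    by simp
  moreover have "{x \<in> space ?M. g (Some (fst x)) (Some (snd x)) < y} = T \<inter> space ?M"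
    using T(2) by (auto simp: space_pair_measure space_restrict_space)
  ultimately show "{x \<in> space ?M. g (Some (fst x)) (Some (snd x)) < y} \<in> sets ?M"
    by simp
qed

theorem theorem4p4:
  fixes D :: "sphere set" and g :: "sphere \<Rightarrow> sphere \<Rightarrow> ereal"
    and K :: "complex set" and f :: "complex \<Rightarrow> ereal"
    and lam :: "complex measure" and \<mu>star :: "real \<Rightarrow> complex measure"
    and R_seq :: "nat \<Rightarrow> real" and R :: real
  assumes "sphere_domain D" and "green_function D g"
    and "compact K" and "Some ` K \<subseteq> D"
    and "\<And>z. z \<in> K \<Longrightarrow> f z \<noteq> -\<infinity>" and "lsc_on K f"
    and "log_capacity {z \<in> K. f z < \<infinity>} > 0"
    and "borel_measure_on K lam" and "prob_space lam"
    and "energy (\<lambda>z \<zeta>. g (Some z) (Some \<zeta>)) lam < \<infinity>"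
    and "\<And>N. R_seq N > 0" and "R_seq \<longlonglongrightarrow> R"
    and "\<And>N. unique_constrained_minimizer g f K lam (R_seq N) (\<mu>star (R_seq N))"
    and "unique_constrained_minimizer g f K lam R (\<mu>star R)"
  shows "weak_star_converges K (\<lambda>N. \<mu>star (R_seq N)) (\<mu>star R) \<and>
         (\<lambda>N. min_energy g f K lam (R_seq N)) \<longlonglongrightarrow> min_energy g f K lam R"
proof -
  have D: "openin sphere_topology D"
    using assms(1) by (simp add: sphere_domain_def)
  obtain c where c: "0 \<le> c" "\<And>z. z \<in> K \<Longrightarrow> - ereal c \<le> f z"
    using lsc_on_compact_bounded_below[OF assms(3,6,5)] by blast
  \<comment> \<open>Upper semicontinuity makes the kernel measurable, lower semicontinuity the
    field, and compactness of \<open>K\<close> supplies \<open>c\<close>.\<close>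
  interpret constrained_energy_problem K g f c lam
  proof
    show "(\<lambda>x. e2ennreal (g (Some (fst x)) (Some (snd x)))) \<in>
        borel_measurable (restrict_space borel K \<Otimes>\<^sub>M restrict_space borel K)"
      using green_function_measurable[OF D assms(2,4)] by measurable
    show "0 \<le> g (Some z) (Some \<zeta>)" if "z \<in> K" "\<zeta> \<in> K" for z \<zeta>
      using assms(4) that by (intro green_function_nonneg[OF assms(2)]) auto
  qed (fact lsc_on_borel_measurable[OF assms(6)] c assms(8))+
  show ?thesis
    using minimizers_converge[OF assms(3,11,12) _ assms(14), of "\<lambda>N. \<mu>star (R_seq N)"] assms(13)
    by (simp add: unique_constrained_minimizer_def)
qed

end
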